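(* Let $P$ be a set of $n$ points, each belonging to one of two groups $\mathbf{g}_1,\mathbf{g}_2$, ordered by the value of an attribute $x$, and let $m$ divide both $|\mathbf{g}_1|$ and $|\mathbf{g}_2|$. There is an algorithm running in $O(n\log n)$ time that finds a cut-based hashmap with $m$ buckets which is a $(0,2)$-hashmap: it uses at most $2(m-1)$ boundaries, every bucket contains exactly $|\mathbf{g}_i|/m$ points of $\mathbf{g}_i$ for $i=1,2$, and hence its collision probability and its single-fairness probabilities for both groups equal $\frac1m$.
   Context: Let $p_1,\dots,p_n$ be $P$ sorted by attribute $x$ (ties broken arbitrarily). A cut-based hashmap partitions this sequence into contiguous bins by placing boundaries between consecutive points and assigns each bin to one of $m$ buckets. It is $\alpha$-memory if it uses at most $\alpha(m-1)$ boundaries, and $\varepsilon$-unfair if $\max_i\sum_j(\alpha_{i,j}/|\mathbf{g}_i|)^2\le\frac{1+\varepsilon}{m}$, where $\alpha_{i,j}$ is the number of points of $\mathbf{g}_i$ in bucket $j$; a $(\varepsilon,\alpha)$-hashmap is both. With $n_j$ the number of points in bucket $j$, collision probability is $\sum_j(n_j/n)^2$ and single fairness of group $i$ is $\sum_j\frac{\alpha_{i,j}}{|\mathbf{g}_i|}\frac{n_j}{n}$. *)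

theory Defs
  imports Complex_Main "HOL-Library.Landau_Symbols"
begin

section \<open>Cut-based hashmaps\<close>

text \<open>
  The list \<^term>\<open>order\<close> is the sequence $p_1,\dots,p_n$. A boundary $b$ lies between
  $p_b$ and $p_{b+1}$, that is, between the list positions $b-1$ and $b$. With $k$ boundaries
  there are $k+1$ bins, numbered from $0$; \<^term>\<open>assign\<close> sends a bin to its bucket.
\<close>

datatype 'p hashmap =
  Hashmap (order: "'p list") (boundaries: "nat list") (assign: "nat \<Rightarrow> nat")

text \<open>Requiring sortedness of the order and nothing else leaves ties broken arbitrarily.\<close>

definition cut_based :: "'p set \<Rightarrow> ('p \<Rightarrow> real) \<Rightarrow> nat \<Rightarrow> 'p hashmap \<Rightarrow> bool" where
  "cut_based P x m H \<longleftrightarrow>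
     distinct (order H) \<and> set (order H) = P \<and> sorted (map x (order H)) \<and>
     sorted_wrt (<) (boundaries H) \<and> set (boundaries H) \<subseteq> {1..<card P} \<and>
     (\<forall>k \<le> length (boundaries H). assign H k \<in> {1..m})"

definition bin :: "'p hashmap \<Rightarrow> nat \<Rightarrow> 'p set" where
  "bin H k = {order H ! i |i. i < length (order H) \<and>
                length (filter (\<lambda>b. b \<le> i) (boundaries H)) = k}"

definition bucket :: "'p hashmap \<Rightarrow> nat \<Rightarrow> 'p set" where
  "bucket H j = (\<Union>k\<in>{k. k \<le> length (boundaries H) \<and> assign H k = j}. bin H k)"

definition group_of :: "'p set \<Rightarrow> ('p \<Rightarrow> nat) \<Rightarrow> nat \<Rightarrow> 'p set" where
  "group_of P g i = {p \<in> P. g p = i}"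

definition group_count :: "'p set \<Rightarrow> ('p \<Rightarrow> nat) \<Rightarrow> 'p hashmap \<Rightarrow> nat \<Rightarrow> nat \<Rightarrow> nat" where
  "group_count P g H i j = card (group_of P g i \<inter> bucket H j)"

definition alpha_memory :: "real \<Rightarrow> nat \<Rightarrow> 'p hashmap \<Rightarrow> bool" where
  "alpha_memory \<alpha> m H \<longleftrightarrow> real (length (boundaries H)) \<le> \<alpha> * (real m - 1)"

definition eps_unfair ::
  "real \<Rightarrow> 'p set \<Rightarrow> ('p \<Rightarrow> nat) \<Rightarrow> nat \<Rightarrow> 'p hashmap \<Rightarrow> bool" where
  "eps_unfair \<epsilon> P g m H \<longleftrightarrow>
     (MAX i\<in>{1, 2}. \<Sum>j = 1..m. (real (group_count P g H i j) / real (card (group_of P g i)))\<^sup>2)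
       \<le> (1 + \<epsilon>) / real m"

definition eps_alpha_hashmap ::
  "real \<Rightarrow> real \<Rightarrow> 'p set \<Rightarrow> ('p \<Rightarrow> real) \<Rightarrow> ('p \<Rightarrow> nat) \<Rightarrow> nat \<Rightarrow> 'p hashmap \<Rightarrow> bool" where
  "eps_alpha_hashmap \<epsilon> \<alpha> P x g m H \<longleftrightarrow>
     cut_based P x m H \<and> eps_unfair \<epsilon> P g m H \<and> alpha_memory \<alpha> m H"

definition collision_probability :: "'p set \<Rightarrow> nat \<Rightarrow> 'p hashmap \<Rightarrow> real" where
  "collision_probability P m H = (\<Sum>j = 1..m. (real (card (bucket H j)) / real (card P))\<^sup>2)"

definition single_fairness ::
  "'p set \<Rightarrow> ('p \<Rightarrow> nat) \<Rightarrow> nat \<Rightarrow> 'p hashmap \<Rightarrow> nat \<Rightarrow> real" where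
  "single_fairness P g m H i =
     (\<Sum>j = 1..m. real (group_count P g H i j) / real (card (group_of P g i)) *
                  (real (card (bucket H j)) / real (card P)))"

section \<open>Algorithms and their running time\<close>

text \<open>
  Algorithms are programs of a uniform-cost random access machine with structured control
  flow. Memory consists of scalar variables and arrays of natural numbers; the arithmetic is
  addition and truncated subtraction. The input points are read-only and are addressed by their
  index: a program may compare the attribute values of two points and read the group of a point.
\<close>

type_synonym vname = string

datatype aexp =
    Const nat
  | Var vname
  | Read vname aexp
  | Plus aexp aexp
  | Minus aexp aexp
  | Group aexp

datatype bexp =
    Less aexp aexp
  | KeyLess aexp aexp
  | Neg bexp
  | Conj bexp bexp

datatype com =
    Skip
  | Assign vname aexp
  | Write vname aexp aexp
  | Seq com com
  | Cond bexp com com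
  | While bexp com

text \<open>\<^term>\<open>key i\<close> and \<^term>\<open>grp i\<close> are the attribute value and the group of the input point \<^term>\<open>i\<close>.\<close>

datatype input = Input (key: "nat \<Rightarrow> real") (grp: "nat \<Rightarrow> nat")

datatype state = State (vars: "vname \<Rightarrow> nat") (arrays: "vname \<Rightarrow> nat \<Rightarrow> nat")

fun aval :: "input \<Rightarrow> state \<Rightarrow> aexp \<Rightarrow> nat" where
  "aval I s (Const k) = k"
| "aval I s (Var v) = vars s v"
| "aval I s (Read a e) = arrays s a (aval I s e)"
| "aval I s (Plus e f) = aval I s e + aval I s f"
| "aval I s (Minus e f) = aval I s e - aval I s f"
| "aval I s (Group e) = grp I (aval I s e)"

fun bval :: "input \<Rightarrow> state \<Rightarrow> bexp \<Rightarrow> bool" where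
  "bval I s (Less e f) \<longleftrightarrow> aval I s e < aval I s f"
| "bval I s (KeyLess e f) \<longleftrightarrow> key I (aval I s e) < key I (aval I s f)"
| "bval I s (Neg b) \<longleftrightarrow> \<not> bval I s b"
| "bval I s (Conj b c) \<longleftrightarrow> bval I s b \<and> bval I s c"

fun acost :: "aexp \<Rightarrow> nat" where
  "acost (Const k) = 1"
| "acost (Var v) = 1"
| "acost (Read a e) = 1 + acost e"
| "acost (Plus e f) = 1 + acost e + acost f"
| "acost (Minus e f) = 1 + acost e + acost f"
| "acost (Group e) = 1 + acost e"

fun bcost :: "bexp \<Rightarrow> nat" where
  "bcost (Less e f) = 1 + acost e + acost f"
| "bcost (KeyLess e f) = 1 + acost e + acost f"
| "bcost (Neg b) = 1 + bcost b"
| "bcost (Conj b c) = 1 + bcost b + bcost c"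

fun set_var :: "vname \<Rightarrow> nat \<Rightarrow> state \<Rightarrow> state" where
  "set_var v k (State V A) = State (V(v := k)) A"

fun set_cell :: "vname \<Rightarrow> nat \<Rightarrow> nat \<Rightarrow> state \<Rightarrow> state" where
  "set_cell a i k (State V A) = State V (A(a := (A a)(i := k)))"

text \<open>\<^term>\<open>exec I c s t s'\<close>: on input \<^term>\<open>I\<close>, started in \<^term>\<open>s\<close>, the program \<^term>\<open>c\<close>
  terminates in \<^term>\<open>s'\<close> after \<^term>\<open>t\<close> steps.\<close>

inductive exec :: "input \<Rightarrow> com \<Rightarrow> state \<Rightarrow> nat \<Rightarrow> state \<Rightarrow> bool" for I where
  exec_Skip: "exec I Skip s 1 s"
| exec_Assign: "exec I (Assign v e) s (1 + acost e) (set_var v (aval I s e) s)"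
| exec_Write: "exec I (Write a e f) s (1 + acost e + acost f)
                 (set_cell a (aval I s e) (aval I s f) s)"
| exec_Seq: "exec I c s t s' \<Longrightarrow> exec I d s' u s'' \<Longrightarrow> exec I (Seq c d) s (t + u) s''"
| exec_CondTrue: "bval I s b \<Longrightarrow> exec I c s t s' \<Longrightarrow> exec I (Cond b c d) s (1 + bcost b + t) s'"
| exec_CondFalse: "\<not> bval I s b \<Longrightarrow> exec I d s t s' \<Longrightarrow> exec I (Cond b c d) s (1 + bcost b + t) s'"
| exec_WhileFalse: "\<not> bval I s b \<Longrightarrow> exec I (While b c) s (1 + bcost b) s"
| exec_WhileTrue: "bval I s b \<Longrightarrow> exec I c s t s' \<Longrightarrow> exec I (While b c) s' u s''
                 \<Longrightarrow> exec I (While b c) s (1 + bcost b + t + u) s''"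

inductive_cases exec_SkipE: "exec I Skip s t s'"
inductive_cases exec_AssignE: "exec I (Assign v e) s t s'"
inductive_cases exec_WriteE: "exec I (Write a e f) s t s'"
inductive_cases exec_SeqE: "exec I (Seq c d) s t s'"
inductive_cases exec_CondE: "exec I (Cond b c d) s t s'"
inductive_cases exec_WhileE: "exec I (While b c) s t s'"

text \<open>Programs are deterministic, so a terminating run is the only run.\<close>

lemma exec_deterministic:
  "exec I c s t s' \<Longrightarrow> exec I c s u s'' \<Longrightarrow> t = u \<and> s' = s''"
proof (induction arbitrary: u s'' rule: exec.induct)
  case (exec_Skip s)
  then show ?case by (rule exec_SkipE) simp
next
  case (exec_Assign v e s)
  then show ?case by (rule exec_AssignE) simp
next
  case (exec_Write a e f s)
  then show ?case by (rule exec_WriteE) simp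
next
  case (exec_Seq c s t s' d t' r)
  from exec_Seq.prems obtain t1 s1 t2 where
    1: "exec I c s t1 s1" and 2: "exec I d s1 t2 s''" and u: "u = t1 + t2"
    by (rule exec_SeqE)
  from exec_Seq.IH(1)[OF 1] have "t = t1" "s' = s1" by (rule conjunct1, rule conjunct2)
  with exec_Seq.IH(2) 2 u show ?case by metis
next
  case (exec_CondTrue s b c t s' d)
  from exec_CondTrue.prems show ?case
    by (rule exec_CondE) (use exec_CondTrue in \<open>metis add_Suc plus_1_eq_Suc\<close>)+
next
  case (exec_CondFalse s b d t s' c)
  from exec_CondFalse.prems show ?case
    by (rule exec_CondE) (use exec_CondFalse in \<open>metis add_Suc plus_1_eq_Suc\<close>)+
next
  case (exec_WhileFalse s b c)
  from exec_WhileFalse.prems show ?case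
    by (rule exec_WhileE) (use exec_WhileFalse.hyps in simp_all)
next
  case (exec_WhileTrue s b c t s' t' r)
  from exec_WhileTrue.prems show ?case
  proof (rule exec_WhileE)
    assume "\<not> bval I s b"
    with exec_WhileTrue.hyps show ?thesis by blast
  next
    fix t1 s1 t2
    assume u: "u = Suc (bcost b + t1 + t2)"
      and 1: "exec I c s t1 s1" and 2: "exec I (While b c) s1 t2 s''"
    from exec_WhileTrue.IH(1)[OF 1] have "t = t1" "s' = s1" by (rule conjunct1, rule conjunct2)
    moreover from this exec_WhileTrue.IH(2) 2 have "t' = t2" "r = s''" by metis+
    ultimately show ?thesis using u by simp
  qed
qed

text \<open>
  The points of the input are presented as an array in an arbitrary order. All memory is zero at
  the start except for the numbers of points and of buckets.
\<close>

definition point_input :: "'p list \<Rightarrow> ('p \<Rightarrow> real) \<Rightarrow> ('p \<Rightarrow> nat) \<Rightarrow> input" where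
  "point_input ps x g = Input (\<lambda>i. x (ps ! i)) (\<lambda>i. g (ps ! i))"

definition initial_state :: "nat \<Rightarrow> nat \<Rightarrow> state" where
  "initial_state n m = State ((\<lambda>_. 0)(''n'' := n, ''m'' := m)) (\<lambda>_ _. 0)"

text \<open>
  The hashmap which a program returns: the array \<open>order\<close> lists the indices of the points in
  sorted order, \<open>boundaries\<close> lists the \<open>k\<close> boundaries, and \<open>assign\<close> the buckets of the bins.
\<close>

definition output_hashmap :: "'p list \<Rightarrow> state \<Rightarrow> 'p hashmap" where
  "output_hashmap ps s =
     Hashmap (map (\<lambda>i. ps ! arrays s ''order'' i) [0..<length ps])
             (map (arrays s ''boundaries'') [0..<vars s ''k''])
             (arrays s ''assign'')"

end

theory Submission
  imports Defs "HOL-Real_Asymp.Real_Asymp"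
begin

text \<open>
  Write $n = mL$ and let each bucket be due $a$ points of group 1. After sorting, push the positions
  onto a stack one by one; whenever the top $L$ entries contain exactly $a$ points of group 1, pop
  them into a new bucket. No window of $L$ consecutive stack entries is then ever balanced. If the
  stack were not empty at the end, its length would be a multiple of $L$ and its content balanced on
  average, and since the number of group 1 points in a window changes by at most 1 when the window
  moves by one position, some window would be balanced. Hence the stack ends up empty. Each popped
  window is contiguous in the sequence of positions not yet assigned, so it creates at most two
  boundaries, and the last one popped creates none. All of this takes linear time; merge sort
  dominates.
\<close>

text \<open>The bound on boundaries amounts to undoing the pops: starting from nothing, reinsert the
  windows, last popped first. Each is a block of one colour put in at one place, so it splits at
  most one run and adds one. Since later pops decide the colours around a window, the run bound has
  to hold for every completion of the colouring. Linear time rests on two devices. Prefix counts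
  \<open>D\<close> along the stack decide in constant time whether the top window is balanced, and
  no other window needs a test: a push creates only that one, and a pop creates none. The cost of a
  pop is charged to the pushes by a potential proportional to the stack height. Group 2 is never
  counted: a bucket with \<open>L\<close> points, \<open>a\<close> of them in group 1, has
  \<open>L - a\<close> in group 2. The final stack is balanced on average because every popped
  window has the density of the whole sequence.\<close>

section \<open>Weakest preconditions with elapsed time\<close>

text \<open>The number $t$ of steps made so far is threaded through, so that the postcondition can bound
  the total.\<close>

definition wp :: "input \<Rightarrow> com \<Rightarrow> (state \<Rightarrow> nat \<Rightarrow> bool) \<Rightarrow> state \<Rightarrow> nat \<Rightarrow> bool" where
  "wp I c Q s t \<longleftrightarrow> (\<exists>u s'. exec I c s u s' \<and> Q s' (t + u))"

fun wvars :: "com \<Rightarrow> vname set" where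
  "wvars Skip = {}"
| "wvars (Assign v e) = {v}"
| "wvars (Write a e f) = {}"
| "wvars (Seq c d) = wvars c \<union> wvars d"
| "wvars (Cond b c d) = wvars c \<union> wvars d"
| "wvars (While b c) = wvars c"

fun warrays :: "com \<Rightarrow> vname set" where
  "warrays Skip = {}"
| "warrays (Assign v e) = {}"
| "warrays (Write a e f) = {a}"
| "warrays (Seq c d) = warrays c \<union> warrays d"
| "warrays (Cond b c d) = warrays c \<union> warrays d"
| "warrays (While b c) = warrays c"

text \<open>A purely syntactic frame: it holds for every run, so the specifications below list only
  what a program computes.\<close>

definition framed :: "com \<Rightarrow> state \<Rightarrow> state \<Rightarrow> bool" where
  "framed c s s' \<longleftrightarrow> (\<forall>v. v \<notin> wvars c \<longrightarrow> vars s' v = vars s v) \<and>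
     (\<forall>a. a \<notin> warrays c \<longrightarrow> arrays s' a = arrays s a)"

lemma set_var_sel [simp]:
  "vars (set_var v k s) = (vars s)(v := k)" "arrays (set_var v k s) = arrays s"
  by (cases s; simp)+

lemma set_cell_sel [simp]:
  "vars (set_cell a i k s) = vars s"
  "arrays (set_cell a i k s) = (arrays s)(a := (arrays s a)(i := k))"
  by (cases s; simp)+

lemma exec_framed: "exec I c s t s' \<Longrightarrow> framed c s s'"
  by (induction rule: exec.induct) (auto simp: framed_def)

lemma framed_refl [simp]: "framed c s s"
  by (simp add: framed_def)

lemma framed_trans: "framed c s s' \<Longrightarrow> framed c s' s'' \<Longrightarrow> framed c s s''"
  by (simp add: framed_def)

lemma framed_vars: "framed c s s' \<Longrightarrow> v \<notin> wvars c \<Longrightarrow> vars s' v = vars s v"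
  by (simp add: framed_def)

lemma framed_arrays: "framed c s s' \<Longrightarrow> a \<notin> warrays c \<Longrightarrow> arrays s' a = arrays s a"
  by (simp add: framed_def)

lemma wp_Skip [simp]: "wp I Skip Q s t \<longleftrightarrow> Q s (t + 1)"
  unfolding wp_def by (metis exec_Skip exec_SkipE)

lemma wp_Assign [simp]:
  "wp I (Assign v e) Q s t \<longleftrightarrow> Q (set_var v (aval I s e) s) (t + 1 + acost e)"
  unfolding wp_def by (metis exec_Assign exec_AssignE add.assoc)

lemma wp_Write [simp]:
  "wp I (Write a e f) Q s t \<longleftrightarrow>
     Q (set_cell a (aval I s e) (aval I s f) s) (t + 1 + acost e + acost f)"
  unfolding wp_def by (metis exec_Write exec_WriteE add.assoc)

lemma wp_Seq [simp]: "wp I (Seq c d) Q s t \<longleftrightarrow> wp I c (wp I d Q) s t"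
  unfolding wp_def by (fastforce intro: exec_Seq elim!: exec_SeqE simp: add.assoc)

lemma wp_Cond [simp]:
  "wp I (Cond b c d) Q s t \<longleftrightarrow>
     (if bval I s b then wp I c Q s (t + 1 + bcost b) else wp I d Q s (t + 1 + bcost b))"
  unfolding wp_def
  by (auto intro: exec_CondTrue exec_CondFalse elim!: exec_CondE simp: add.assoc)
     (metis add.assoc plus_1_eq_Suc exec_CondTrue exec_CondFalse add_Suc_right)+

lemma wp_framed: "wp I c Q s t \<Longrightarrow> wp I c (\<lambda>s' t'. Q s' t' \<and> framed c s s') s t"
  unfolding wp_def using exec_framed by blast

lemma wp_consequence:
  assumes "wp I c R s t" and "\<And>s' t'. R s' t' \<Longrightarrow> framed c s s' \<Longrightarrow> Q s' t'"
  shows "wp I c Q s t"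
  using wp_framed[OF assms(1)] assms(2) unfolding wp_def by blast

text \<open>Well-founded induction on the variant \<open>\<mu>\<close> gives termination together
  with correctness. The frame in \<open>step\<close> and \<open>exit\<close> refers to the entry
  state \<open>s\<close> of the loop, so \<open>J\<close> need not mention what the loop leaves
  alone. The final guard evaluation is charged in \<open>exit\<close>.\<close>

lemma wp_While:
  fixes \<mu> :: "state \<Rightarrow> nat"
  assumes start: "J s t"
    and step: "\<And>s' t'. J s' t' \<Longrightarrow> bval I s' b \<Longrightarrow> framed c s s' \<Longrightarrow>
      wp I c (\<lambda>s'' t''. J s'' t'' \<and> \<mu> s'' < \<mu> s') s' (t' + 1 + bcost b)"
    and exit: "\<And>s' t'. J s' t' \<Longrightarrow> \<not> bval I s' b \<Longrightarrow> framed c s s' \<Longrightarrow> Q s' (t' + 1 + bcost b)"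
  shows "wp I (While b c) Q s t"
proof -
  have "wp I (While b c) Q s' t'" if "J s' t'" "framed c s s'" for s' t'
    using that
  proof (induction "\<mu> s'" arbitrary: s' t' rule: less_induct)
    case less
    show ?case
    proof (cases "bval I s' b")
      case True
      from step[OF less.prems(1) True less.prems(2)] obtain u s1
        where 1: "exec I c s' u s1" "J s1 (t' + 1 + bcost b + u)" "\<mu> s1 < \<mu> s'"
        unfolding wp_def by blast
      have "framed c s s1"
        using framed_trans[OF less.prems(2) exec_framed[OF 1(1)]] .
      from less.hyps[OF 1(3,2) this] obtain u' s2
        where 2: "exec I (While b c) s1 u' s2" "Q s2 (t' + 1 + bcost b + u + u')"
        unfolding wp_def by blast
      show ?thesis
        unfolding wp_def using exec_WhileTrue[OF True 1(1) 2(1)] 2(2)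
        by (metis add.assoc)
    next
      case False
      with exit[OF less.prems(1) False less.prems(2)] show ?thesis
        unfolding wp_def by (metis exec_WhileFalse add.assoc)
    qed
  qed
  with start show ?thesis by simp
qed

notation Seq (infixr ";;" 60)

abbreviation incr :: "vname \<Rightarrow> com" where
  "incr v \<equiv> Assign v (Plus (Var v) (Const 1))"

section \<open>Initialization and division\<close>

text \<open>A group is 1 or 2, so two minus the group is the indicator of group 1.\<close>

definition init_prog :: com where
  "init_prog = While (Less (Var ''i'') (Var ''n''))
     (Write ''order'' (Var ''i'') (Var ''i'') ;;
      Assign ''c'' (Plus (Var ''c'') (Minus (Const 2) (Group (Var ''i'')))) ;;
      incr ''i'')"

text \<open>One iteration costs 18 steps, guard included; 20 is rounded up, and so are the later
  coefficients.\<close>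

lemma wp_init_prog:
  assumes "vars s ''i'' = 0" "vars s ''c'' = 0"
  shows "wp I init_prog (\<lambda>s' t'. (\<forall>i < vars s ''n''. arrays s' ''order'' i = i) \<and>
     vars s' ''c'' = (\<Sum>i < vars s ''n''. 2 - grp I i) \<and> t' \<le> t + 20 * vars s ''n'' + 10) s t"
  unfolding init_prog_def
proof (rule wp_While[where J = "\<lambda>s' t'. vars s' ''i'' \<le> vars s ''n'' \<and>
      (\<forall>i < vars s' ''i''. arrays s' ''order'' i = i) \<and>
      vars s' ''c'' = (\<Sum>i < vars s' ''i''. 2 - grp I i) \<and> t' \<le> t + 20 * vars s' ''i''"
      and \<mu> = "\<lambda>s'. vars s ''n'' - vars s' ''i''"], goal_cases)
  case 1
  show ?case using assms by simp
next
  case (2 s' t')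
  have "vars s' ''n'' = vars s ''n''" using 2(3) by (simp add: framed_def)
  with 2(1,2) show ?case by (auto simp: less_Suc_eq)
next
  case (3 s' t')
  have "vars s' ''n'' = vars s ''n''" using 3(3) by (simp add: framed_def)
  with 3(1,2) show ?case by auto
qed

text \<open>The machine has no division. Repeated addition of \<open>m\<close> finds how often it
  fits into \<open>n\<close> and into the group 1 count \<open>c\<close>, in a number of iterations
  equal to the sum of the quotients.\<close>

definition div_prog :: com where
  "div_prog =
     While (Less (Var ''x'') (Var ''n''))
       (Assign ''x'' (Plus (Var ''x'') (Var ''m'')) ;; incr ''l'') ;;
     While (Less (Var ''y'') (Var ''c''))
       (Assign ''y'' (Plus (Var ''y'') (Var ''m'')) ;; incr ''a'')"

lemma wp_div_prog:
  assumes "vars s ''x'' = 0" "vars s ''l'' = 0" "vars s ''y'' = 0" "vars s ''a'' = 0"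
    and m: "vars s ''m'' > 0"
    and n: "vars s ''n'' = vars s ''m'' * L" and c: "vars s ''c'' = vars s ''m'' * a"
  shows "wp I div_prog (\<lambda>s' t'. vars s' ''l'' = L \<and> vars s' ''a'' = a \<and>
     t' \<le> t + 20 * L + 20 * a + 20) s t"
  unfolding div_prog_def wp_Seq
proof (rule wp_While[where J = "\<lambda>s' t'. vars s' ''l'' \<le> L \<and>
      vars s' ''x'' = vars s ''m'' * vars s' ''l'' \<and> t' \<le> t + 20 * vars s' ''l''"
      and \<mu> = "\<lambda>s'. L - vars s' ''l''"], goal_cases)
  case 1
  show ?case using assms by simp
next
  case (2 s' t')
  have "vars s' ''n'' = vars s ''n''" "vars s' ''m'' = vars s ''m''"
    using 2(3) by (simp_all add: framed_def)
  with 2(1,2) n m show ?case by (auto)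
next
  case (3 s1 t1)
  have eq: "vars s1 ''n'' = vars s ''n''" "vars s1 ''m'' = vars s ''m''"
      "vars s1 ''y'' = 0" "vars s1 ''a'' = 0" "vars s1 ''c'' = vars s ''c''"
    using 3(3) assms by (simp_all add: framed_def)
  have l: "vars s1 ''l'' = L"
    using 3(1,2) n m eq by auto
  show ?case
  proof (rule wp_While[where J = "\<lambda>s' t'. vars s' ''a'' \<le> a \<and>
      vars s' ''y'' = vars s ''m'' * vars s' ''a'' \<and> t' \<le> t + 20 * L + 10 + 20 * vars s' ''a''"
      and \<mu> = "\<lambda>s'. a - vars s' ''a''"], goal_cases)
    case 1
    show ?case using 3(1) eq l by simp
  next
    case (2 s' t')
    have "vars s' ''c'' = vars s ''c''" "vars s' ''m'' = vars s ''m''"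
      using 2(3) eq by (simp_all add: framed_def)
    with 2(1,2) c m show ?case by (auto)
  next
    case (3 s' t')
    have "vars s' ''c'' = vars s ''c''" "vars s' ''m'' = vars s ''m''" "vars s' ''l'' = L"
      using 3(3) eq l by (simp_all add: framed_def)
    with 3(1,2) c m show ?case by auto
  qed
qed

section \<open>Bottom-up merge sort\<close>

text \<open>\<open>R\<close> is the set of positions of \<open>A\<close> still to be merged. The
  second clause makes any minimum of the remainder a legal next entry.\<close>

definition merged_prefix :: "(nat \<Rightarrow> real) \<Rightarrow> (nat \<Rightarrow> nat) \<Rightarrow> nat \<Rightarrow> (nat \<Rightarrow> nat) \<Rightarrow> nat set \<Rightarrow> nat \<Rightarrow> bool" where
  "merged_prefix f A lo B R p \<longleftrightarrow>
     (\<forall>u v. lo \<le> u \<and> u < v \<and> v < p \<longrightarrow> f (B u) \<le> f (B v)) \<and>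
     (\<forall>u v. lo \<le> u \<and> u < p \<and> v \<in> R \<longrightarrow> f (B u) \<le> f (A v))"

lemma merged_prefix_step:
  assumes "merged_prefix f A lo B R p" "r \<in> R" "\<And>v. v \<in> R \<Longrightarrow> f (A r) \<le> f (A v)" "R' \<subseteq> R"
  shows "merged_prefix f A lo (B(p := A r)) R' (Suc p)"
  using assms unfolding merged_prefix_def by (auto simp: less_Suc_eq)

definition block_sorted :: "(nat \<Rightarrow> real) \<Rightarrow> (nat \<Rightarrow> nat) \<Rightarrow> nat \<Rightarrow> nat \<Rightarrow> bool" where
  "block_sorted f A w n \<longleftrightarrow>
     (\<forall>z u v. z * w \<le> u \<and> u < v \<and> v < (z + 1) * w \<and> v < n \<longrightarrow> f (A u) \<le> f (A v))"

lemma block_sortedD: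
  "block_sorted f A w n \<Longrightarrow> z * w \<le> u \<Longrightarrow> u < v \<Longrightarrow> v < (z + 1) * w \<Longrightarrow> v < n \<Longrightarrow> f (A u) \<le> f (A v)"
  unfolding block_sorted_def by blast

text \<open>No block straddles \<open>y * w\<close>, a multiple of the width: two positions of one
  block lie both below it or both from it onwards.\<close>

lemma block_sorted_extend:
  assumes "block_sorted f B w (y * w)"
    and "\<And>u v. y * w \<le> u \<Longrightarrow> u < v \<Longrightarrow> v < e \<Longrightarrow> f (B u) \<le> f (B v)"
  shows "block_sorted f B w e"
  unfolding block_sorted_def
proof (intro allI impI, elim conjE)
  fix z u v assume *: "z * w \<le> u" "u < v" "v < (z + 1) * w" "v < e"
  show "f (B u) \<le> f (B v)"
  proof (cases "v < y * w")
    case True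
    with * assms(1) show ?thesis unfolding block_sorted_def by blast
  next
    case False
    with * have "y * w < (z + 1) * w" by linarith
    then have "y < z + 1" by (rule mult_right_less_imp_less) simp
    then have "y \<le> z" by simp
    then have "y * w \<le> z * w" by simp
    with * show ?thesis by (intro assms(2)) linarith+
  qed
qed

definition merge_prog :: com where
  "merge_prog = While (Less (Var ''p'') (Var ''e''))
     (Cond (Conj (Less (Var ''i'') (Var ''q''))
                 (Neg (Conj (Less (Var ''j'') (Var ''e''))
                            (KeyLess (Read ''order'' (Var ''j'')) (Read ''order'' (Var ''i''))))))
        (Write ''B'' (Var ''p'') (Read ''order'' (Var ''i'')) ;; incr ''i'')
        (Write ''B'' (Var ''p'') (Read ''order'' (Var ''j'')) ;; incr ''j'') ;;
      incr ''p'')"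

text \<open>Only surjectivity onto the set of indices is tracked; on a finite set it gives injectivity.\<close>

lemma wp_merge_prog:
  fixes s I
  defines "A \<equiv> arrays s ''order''" and "lo \<equiv> vars s ''p''" and "q \<equiv> vars s ''q''" and "e \<equiv> vars s ''e''"
    and "n \<equiv> vars s ''n''"
  assumes vs: "vars s ''i'' = lo" "vars s ''j'' = q" "lo \<le> q" "q \<le> e" "e \<le> n"
    and left: "\<And>u v. lo \<le> u \<Longrightarrow> u < v \<Longrightarrow> v < q \<Longrightarrow> key I (A u) \<le> key I (A v)"
    and right: "\<And>u v. q \<le> u \<Longrightarrow> u < v \<Longrightarrow> v < e \<Longrightarrow> key I (A u) \<le> key I (A v)"
    and surj: "arrays s ''B'' ` {..<lo} \<union> A ` {lo..<n} = X"
  shows "wp I merge_prog (\<lambda>s' t'.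
     (\<forall>u<lo. arrays s' ''B'' u = arrays s ''B'' u) \<and>
     (\<forall>u v. lo \<le> u \<and> u < v \<and> v < e \<longrightarrow> key I (arrays s' ''B'' u) \<le> key I (arrays s' ''B'' v)) \<and>
     arrays s' ''B'' ` {..<e} \<union> A ` {e..<n} = X \<and>
     t' \<le> t + 50 * (e - lo) + 10) s t"
  unfolding merge_prog_def
\<comment> \<open>\<open>p + q = i + j\<close> says that as many entries were written as read. The
  surjectivity clause runs up to \<open>n\<close> instead of \<open>e\<close>, so that it also
  carries the part of the array that the pass has not reached.\<close>
proof (rule wp_While[where J = "\<lambda>s' t'. let i = vars s' ''i''; j = vars s' ''j''; p = vars s' ''p'' in
      lo \<le> i \<and> i \<le> q \<and> q \<le> j \<and> j \<le> e \<and> p + q = i + j \<and>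
      (\<forall>u<lo. arrays s' ''B'' u = arrays s ''B'' u) \<and>
      merged_prefix (key I) A lo (arrays s' ''B'') ({i..<q} \<union> {j..<e}) p \<and>
      arrays s' ''B'' ` {..<p} \<union> A ` ({i..<q} \<union> {j..<n}) = X \<and> t' + 50 * lo \<le> t + 50 * p"
      and \<mu> = "\<lambda>s'. e - vars s' ''p''"], goal_cases)
  case 1
  have "{lo..<q} \<union> {q..<n} = {lo..<n}"
    using vs by auto
  then show ?case using vs surj
    by (auto simp: Let_def lo_def[symmetric] merged_prefix_def)
next
  case (2 s' t')
  define i j p B where d: "i = vars s' ''i''" "j = vars s' ''j''" "p = vars s' ''p''" "B = arrays s' ''B''"
  have eq: "vars s' ''q'' = q" "vars s' ''e'' = e" "arrays s' ''order'' = A"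
    using 2(3) unfolding q_def e_def A_def by (simp_all add: framed_def)
  have J: "lo \<le> i" "i \<le> q" "q \<le> j" "j \<le> e" "p + q = i + j" "\<forall>u<lo. B u = arrays s ''B'' u"
    "merged_prefix (key I) A lo B ({i..<q} \<union> {j..<e}) p"
    "B ` {..<p} \<union> A ` ({i..<q} \<union> {j..<n}) = X" "t' + 50 * lo \<le> t + 50 * p"
    using 2(1) by (simp_all add: Let_def d)
  have p: "p < e" "lo \<le> p" "e - Suc p < e - p" using 2(2) J eq d by simp_all
  have img: "(B(p := A r)) ` {..<Suc p} \<union> A ` R' = X"
    if "insert r R' = {i..<q} \<union> {j..<n}" for r R'
  proof -
    have "(B(p := A r)) ` {..<Suc p} = insert (A r) (B ` {..<p})"
      by (auto simp: lessThan_Suc)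
    then show ?thesis using J(8) that[symmetric] by simp
  qed
  show ?case
  proof (cases "i < q \<and> \<not> (j < e \<and> key I (A j) < key I (A i))")
    case True
    have "key I (A i) \<le> key I (A v)" if "v \<in> {i..<q} \<union> {j..<e}" for v
    proof (cases "v < q")
      case True
      then show ?thesis using that left[of i v] J by (cases "v = i") auto
    next
      case False
      then have "j < e" "j \<le> v" "v < e" using that by auto
      then show ?thesis using right[of j v] J True by (cases "v = j") fastforce+
    qed
    then have m: "merged_prefix (key I) A lo (B(p := A i)) ({Suc i..<q} \<union> {j..<e}) (Suc p)"
      using True by (intro merged_prefix_step[OF J(7)]) auto
    have "insert i ({Suc i..<q} \<union> {j..<n}) = {i..<q} \<union> {j..<n}"
      using True by auto
    note img[OF this]
    then show ?thesis using True m J p eq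
      by (simp add: Let_def d[symmetric] del: fun_upd_image)
  next
    case False
    \<comment> \<open>Either the left run is exhausted and \<open>j = p < e\<close>, or the failed
      test itself gives \<open>j < e\<close>.\<close>
    then have j: "j < e" using p J by auto
    have "key I (A j) \<le> key I (A v)" if "v \<in> {i..<q} \<union> {j..<e}" for v
    proof (cases "v < q")
      case True
      then have "i < q" "i \<le> v" using that J by auto
      then show ?thesis using left[of i v] J True False by (cases "v = i") fastforce+
    next
      case F2: False
      then show ?thesis using that right[of j v] J by (cases "v = j") auto
    qed
    then have m: "merged_prefix (key I) A lo (B(p := A j)) ({i..<q} \<union> {Suc j..<e}) (Suc p)"
      using j by (intro merged_prefix_step[OF J(7)]) auto
    have "insert j ({i..<q} \<union> {Suc j..<n}) = {i..<q} \<union> {j..<n}"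
      using j vs by auto
    note img[OF this]
    then show ?thesis using False j m J p eq
      by (auto simp add: Let_def d[symmetric] simp del: fun_upd_image)
  qed
next
  case (3 s' t')
  have "vars s' ''e'' = e"
    using 3(3) unfolding e_def by (simp add: framed_def)
  with 3 vs have "vars s' ''p'' = e" "vars s' ''i'' = q" "vars s' ''j'' = e"
    by (auto simp: Let_def)
  with 3 show ?case by (auto simp: Let_def merged_prefix_def)
qed

text \<open>Subtraction truncates, hence $n - (n - k)$ is the minimum of $n$ and $k$.\<close>

definition pass_prog :: com where
  "pass_prog = While (Less (Var ''o'') (Var ''n''))
     (Assign ''i'' (Var ''o'') ;; Assign ''p'' (Var ''o'') ;;
      Assign ''q'' (Minus (Var ''n'') (Minus (Var ''n'') (Plus (Var ''o'') (Var ''w'')))) ;;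
      Assign ''j'' (Var ''q'') ;;
      Assign ''e'' (Minus (Var ''n'') (Minus (Var ''n'') (Plus (Var ''q'') (Var ''w'')))) ;;
      merge_prog ;;
      Assign ''o'' (Var ''e''))"

lemma wp_pass_prog:
  fixes s I
  defines "A \<equiv> arrays s ''order''" and "w \<equiv> vars s ''w''" and "n \<equiv> vars s ''n''"
  assumes vs: "vars s ''o'' = 0" "0 < w"
    and sorted: "block_sorted (key I) A w n"
    and surj: "A ` {..<n} = X"
  shows "wp I pass_prog (\<lambda>s' t'. block_sorted (key I) (arrays s' ''B'') (2 * w) n \<and>
     arrays s' ''B'' ` {..<n} = X \<and> t' \<le> t + 150 * n + 10) s t"
  unfolding pass_prog_def
\<comment> \<open>The last pair of blocks may be cut off by \<open>n\<close>; hence the alternative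
  \<open>lo = n\<close> beside divisibility by \<open>2 * w\<close>.\<close>
proof (rule wp_While[where J = "\<lambda>s' t'. let lo = vars s' ''o'' in
      lo \<le> n \<and> (lo = n \<or> (2 * w) dvd lo) \<and>
      block_sorted (key I) (arrays s' ''B'') (2 * w) lo \<and>
      arrays s' ''B'' ` {..<lo} \<union> A ` {lo..<n} = X \<and> t' \<le> t + 150 * lo"
      and \<mu> = "\<lambda>s'. n - vars s' ''o''"], goal_cases)
  case 1
  then show ?case using vs surj by (auto simp: Let_def block_sorted_def lessThan_atLeast0)
next
  case (2 s' t')
  define lo B where d: "lo = vars s' ''o''" "B = arrays s' ''B''"
  define q where "q = n - (n - (lo + w))"
  define e where "e = n - (n - (q + w))"
  have eq: "vars s' ''n'' = n" "vars s' ''w'' = w" "arrays s' ''order'' = A"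
    using 2(3) unfolding n_def w_def A_def by (simp_all add: framed_def merge_prog_def)
  have lo: "lo < n" using 2(2) eq d by simp
  then obtain y where y: "lo = y * (2 * w)" using 2(1) d by (auto simp: Let_def dvd_def mult.commute)
  have J: "block_sorted (key I) B (2 * w) lo" "B ` {..<lo} \<union> A ` {lo..<n} = X" "t' \<le> t + 150 * lo"
    using 2(1) d by (simp_all add: Let_def)
  have q: "q = min (lo + w) n" and e: "e = min (lo + 2 * w) n"
    using lo by (auto simp: q_def e_def)
  have qe: "lo < e" "lo \<le> q" "q \<le> e" "e \<le> n" using q e lo \<open>0 < w\<close> by auto
  \<comment> \<open>With \<open>lo = y * (2 * w)\<close>, the runs to be merged are the blocks
    \<open>2 * y\<close> and \<open>2 * y + 1\<close> of width \<open>w\<close>.\<close>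
  have left: "key I (A u) \<le> key I (A v)" if "lo \<le> u" "u < v" "v < q" for u v
    by (rule block_sortedD[OF sorted, of "2 * y"]) (use that q y in \<open>simp_all add: algebra_simps\<close>)
  have right: "key I (A u) \<le> key I (A v)" if "q \<le> u" "u < v" "v < e" for u v
    by (rule block_sortedD[OF sorted, of "2 * y + 1"])
       (use that q e y in \<open>auto simp: algebra_simps\<close>)
  have goal: "block_sorted (key I) B' (2 * w) e"
    if "\<forall>u<lo. B' u = B u" "\<forall>u v. lo \<le> u \<and> u < v \<and> v < e \<longrightarrow> key I (B' u) \<le> key I (B' v)" for B'
  proof (rule block_sorted_extend[of _ _ _ y])
    show "block_sorted (key I) B' (2 * w) (y * (2 * w))"
      using J(1) that(1) unfolding y block_sorted_def by auto
  qed (use that y in auto)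
  have dvd: "e = n \<or> 2 * w dvd e"
    using e y by (auto simp: min_def intro: dvd_add)
  show ?case
    unfolding wp_Seq wp_Assign
  proof (rule wp_consequence[OF wp_merge_prog[where X = X]], goal_cases)
    case (9 s1 t1)
    have "vars s1 ''e'' = e"
      using 9(2) by (simp add: framed_def merge_prog_def eq d[symmetric] q_def[symmetric] e_def[symmetric])
    moreover have "block_sorted (key I) (arrays s1 ''B'') (2 * w) e"
      by (rule goal) (use 9 in \<open>simp_all add: eq d[symmetric] q_def[symmetric] e_def[symmetric]\<close>)
    ultimately show ?case
      using 9(1) dvd qe J(3) by (auto simp: Let_def eq d[symmetric] q_def[symmetric] e_def[symmetric])
  qed (use left right qe J(2) in \<open>simp_all add: eq d[symmetric] q_def[symmetric] e_def[symmetric]\<close>)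
next
  case (3 s' t')
  have "vars s' ''n'' = n"
    using 3(3) unfolding n_def by (simp add: framed_def merge_prog_def)
  with 3 show ?case by (auto simp: Let_def)
qed

definition copy_prog :: com where
  "copy_prog = While (Less (Var ''i'') (Var ''n''))
     (Write ''order'' (Var ''i'') (Read ''B'' (Var ''i'')) ;; incr ''i'')"

lemma wp_copy_prog:
  assumes "vars s ''i'' = 0"
  shows "wp I copy_prog (\<lambda>s' t'. (\<forall>u < vars s ''n''. arrays s' ''order'' u = arrays s ''B'' u) \<and>
     t' \<le> t + 20 * vars s ''n'' + 10) s t"
  unfolding copy_prog_def
proof (rule wp_While[where J = "\<lambda>s' t'. vars s' ''i'' \<le> vars s ''n'' \<and>
      (\<forall>u < vars s' ''i''. arrays s' ''order'' u = arrays s ''B'' u) \<and> t' \<le> t + 20 * vars s' ''i''"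
      and \<mu> = "\<lambda>s'. vars s ''n'' - vars s' ''i''"], goal_cases)
  case 1
  show ?case using assms by simp
next
  case (2 s' t')
  have "vars s' ''n'' = vars s ''n''" "arrays s' ''B'' = arrays s ''B''"
    using 2(3) by (simp_all add: framed_def)
  with 2(1,2) show ?case by (auto simp: less_Suc_eq)
next
  case (3 s' t')
  have "vars s' ''n'' = vars s ''n''" using 3(3) by (simp add: framed_def)
  with 3(1,2) show ?case by auto
qed

definition sort_prog :: com where
  "sort_prog = Assign ''w'' (Const 1) ;;
     While (Less (Var ''w'') (Var ''n''))
       (Assign ''o'' (Const 0) ;; pass_prog ;;
        Assign ''i'' (Const 0) ;; copy_prog ;;
        Assign ''w'' (Plus (Var ''w'') (Var ''w'')))"

lemma block_sorted_cong:
  "(\<And>u. u < n \<Longrightarrow> A u = A' u) \<Longrightarrow> block_sorted f A w n \<longleftrightarrow> block_sorted f A' w n"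
  unfolding block_sorted_def by (metis less_trans)

text \<open>\<open>r\<close> counts the passes, so \<open>w = 2 ^ r\<close>. A pass starts only if
  \<open>w < n\<close>, hence doubling keeps \<open>w\<close> at most \<open>2 * n\<close>. The term
  \<open>300 * n\<close> covers one merge pass, the copy back and their overhead.\<close>

lemma wp_sort_prog:
  fixes s I
  defines "n \<equiv> vars s ''n''"
  assumes id: "\<forall>i<n. arrays s ''order'' i = i" and "0 < n"
  shows "wp I sort_prog (\<lambda>s' t'.
     (\<forall>u v. u < v \<and> v < n \<longrightarrow> key I (arrays s' ''order'' u) \<le> key I (arrays s' ''order'' v)) \<and>
     arrays s' ''order'' ` {..<n} = {..<n} \<and>
     (\<exists>r. 2 ^ r \<le> 2 * n \<and> t' \<le> t + 300 * n * r + 20)) s t"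
  unfolding sort_prog_def wp_Seq wp_Assign
proof (rule wp_While[where J = "\<lambda>s' t'. let w = vars s' ''w'' in
      block_sorted (key I) (arrays s' ''order'') w n \<and> arrays s' ''order'' ` {..<n} = {..<n} \<and>
      0 < w \<and> w \<le> 2 * n \<and> (\<exists>r. w = 2 ^ r \<and> t' \<le> t + 300 * n * r + 10)"
      and \<mu> = "\<lambda>s'. 2 * n - vars s' ''w''"], goal_cases)
  case 1
  have "arrays s ''order'' ` {..<n} = {..<n}"
    using id by force
  moreover have "block_sorted (key I) (arrays s ''order'') 1 n"
    by (auto simp: block_sorted_def)
  ultimately show ?case using \<open>0 < n\<close> by (auto simp: Let_def intro!: exI[of _ 0])
next
  case (2 s' t')
  define w A where d: "w = vars s' ''w''" "A = arrays s' ''order''"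
  have n: "vars s' ''n'' = n"
    using 2(3) unfolding n_def by (simp add: framed_def pass_prog_def merge_prog_def copy_prog_def)
  obtain r where J: "block_sorted (key I) A w n" "A ` {..<n} = {..<n}" "0 < w"
      and r: "w = 2 ^ r" "t' \<le> t + 300 * n * r + 10"
    using 2(1) by (auto simp: Let_def d)
  have w: "w < n" using 2(2) n d by simp
  show ?case
    unfolding wp_Seq wp_Assign
  proof (rule wp_consequence[OF wp_pass_prog[where X = "{..<n}"]], goal_cases)
    case (5 s1 t1)
    have eq1: "vars s1 ''n'' = n" "vars s1 ''w'' = w"
      using 5(2) by (simp_all add: framed_def pass_prog_def merge_prog_def n d)
    show ?case
    proof (rule wp_consequence[OF wp_copy_prog], goal_cases)
      case (2 s2 t2)
      have eq2: "vars s2 ''n'' = n" "vars s2 ''w'' = w"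
        using 2(2) by (simp_all add: framed_def copy_prog_def eq1)
      have B: "arrays s2 ''order'' u = arrays s1 ''B'' u" if "u < n" for u
        using 2(1) that by (simp add: eq1)
      have "block_sorted (key I) (arrays s2 ''order'') (2 * w) n"
        using 5(1) block_sorted_cong[OF B] by (simp add: n d)
      moreover have "arrays s2 ''order'' ` {..<n} = {..<n}"
        using 5(1) B by (simp add: n)
      moreover have "2 * n - (w + w) < 2 * n - w"
        using w J(3) by linarith
      ultimately show ?case
        using 2(1) 5(1) r w by (auto simp: Let_def eq1 eq2 n d(1)[symmetric] mult_2 intro!: exI[of _ "Suc r"])
    qed simp
  qed (use J in \<open>simp_all add: n d\<close>)
next
  case (3 s' t')
  have "vars s' ''n'' = n"
    using 3(3) unfolding n_def by (simp add: framed_def pass_prog_def merge_prog_def copy_prog_def)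
  \<comment> \<open>On exit \<open>w\<close> is at least \<open>n\<close>, so block 0 is the whole
    array.\<close>
  with 3(1,2) block_sortedD[of "key I" "arrays s' ''order''" "vars s' ''w''" n 0] show ?case
    by (force simp: Let_def)
qed

section \<open>Popping balanced windows\<close>

text \<open>The offset for nonempty lists makes every inserted block, even into the empty list, cost at
  most two; it accounts for the last bucket creating no boundary.\<close>

definition padded_runs :: "'a list \<Rightarrow> nat" where
  "padded_runs xs = (if xs = [] then 0 else Suc (length (remdups_adj xs)))"

lemma length_remdups_adj_snoc:
  "length (remdups_adj (xs @ [x])) = length (remdups_adj xs) + (if xs \<noteq> [] \<and> last xs = x then 0 else 1)"
proof (cases xs rule: rev_cases)
  case (snoc ys y)
  then show ?thesis by (simp add: remdups_adj_append_two)
qed simp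

text \<open>Concatenation can fuse only the last run of \<open>xs\<close> with the first run of
  \<open>ys\<close>.\<close>

lemma length_remdups_adj_append:
  "length (remdups_adj (xs @ ys)) \<le> length (remdups_adj xs) + length (remdups_adj ys)"
  "length (remdups_adj xs) + length (remdups_adj ys) \<le> length (remdups_adj (xs @ ys)) + 1"
proof -
  have "length (remdups_adj (xs @ ys)) \<le> length (remdups_adj xs) + length (remdups_adj ys) \<and>
    length (remdups_adj xs) + length (remdups_adj ys) \<le> length (remdups_adj (xs @ ys)) + 1"
  proof (cases ys)
    case (Cons z zs)
    have "length (remdups_adj (xs @ ys)) =
        length (remdups_adj (xs @ [z])) + (length (remdups_adj ys) - 1)"
      unfolding Cons remdups_adj_append[of xs z zs] by simp
    moreover have "length (remdups_adj ys) \<ge> 1" by (simp add: Cons Suc_le_eq)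
    ultimately show ?thesis by (auto simp: length_remdups_adj_snoc)
  qed simp
  then show "length (remdups_adj (xs @ ys)) \<le> length (remdups_adj xs) + length (remdups_adj ys)"
    "length (remdups_adj xs) + length (remdups_adj ys) \<le> length (remdups_adj (xs @ ys)) + 1"
    by blast+
qed

text \<open>Cutting \<open>xs @ ys\<close> open adds at most one run and the block at most one more;
  if \<open>xs @ ys\<close> is empty, the two units are the new run and the padding.\<close>

lemma padded_runs_insert_block:
  assumes "\<And>w. w \<in> set ws \<Longrightarrow> w = c"
  shows "padded_runs (xs @ ws @ ys) \<le> padded_runs (xs @ ys) + 2"
proof -
  have "ws = replicate (length ws) c"
    using assms by (simp add: replicate_eqI)
  then have "length (remdups_adj ws) \<le> 1"
    by (metis remdups_adj_replicate list.size(3,4) One_nat_def le_refl plus_1_eq_Suc add.commute zero_le)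
  then show ?thesis
    using length_remdups_adj_append(1)[of xs "ws @ ys"] length_remdups_adj_append(1)[of ws ys]
      length_remdups_adj_append(2)[of xs ys]
    by (auto simp: padded_runs_def)
qed

text \<open>Converts runs into boundaries: every run but the first starts at a colour
  change.\<close>

lemma length_remdups_adj_upt:
  "length (remdups_adj (map f [0..<Suc n])) = Suc (length (filter (\<lambda>i. f (i - 1) \<noteq> f i) [1..<Suc n]))"
proof (induction n)
  case (Suc n)
  have "map f [0..<Suc (Suc n)] = map f [0..<Suc n] @ [f (Suc n)]" by simp
  moreover have "last (map f [0..<Suc n]) = f n" by simp
  moreover have "map f [0..<Suc n] \<noteq> []" by simp
  ultimately show ?case using Suc by (simp only: length_remdups_adj_snoc) auto
qed simp

text \<open>Discrete intermediate value theorem: the excess of a window over its mean moves in unit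
  steps, so it has a constant sign unless some window is balanced.\<close>

lemma balanced_window:
  fixes D :: "nat \<Rightarrow> nat"
  assumes D0: "D 0 = 0" and mono: "\<And>u. u < q * L \<Longrightarrow> D u \<le> D (Suc u) \<and> D (Suc u) \<le> Suc (D u)"
    and q: "0 < q" and total: "D (q * L) = q * a"
  shows "\<exists>u. u + L \<le> q * L \<and> D (u + L) = D u + a"
proof (rule ccontr)
  assume "\<not> ?thesis"
  then have no: "D (u + L) \<noteq> D u + a" if "u + L \<le> q * L" for u using that by blast
  have sign: "D u + a < D (u + L) \<longleftrightarrow> a < D L" if "u + L \<le> q * L" for u
    using that
  proof (induction u)
    case 0
    then show ?case by (simp add: D0)
  next
    case (Suc u)
    then have "D (u + L) \<noteq> D u + a" "D (Suc u + L) \<noteq> D (Suc u) + a" using no by (auto simp del: add_Suc)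
    moreover have "D u \<le> D (Suc u) \<and> D (Suc u) \<le> Suc (D u)"
      "D (u + L) \<le> D (Suc u + L) \<and> D (Suc u + L) \<le> Suc (D (u + L))"
      using Suc.prems mono[of u] mono[of "u + L"] by auto
    ultimately show ?case using Suc by linarith
  qed
  have step: "p * L + L \<le> q * L" if "p < q" for p
    using mult_le_mono1[of "Suc p" q L] that by simp
  show False
  proof (cases "a < D L")
    case True
    \<comment> \<open>Tile the \<open>q * L\<close> positions by \<open>q\<close> windows. If each
      exceeds \<open>a\<close> by at least 1, the total exceeds \<open>q * a\<close> by at least
      \<open>q\<close>; the other sign is symmetric.\<close>
    have "p \<le> q \<Longrightarrow> p * a + p \<le> D (p * L)" for p
    proof (induction p)
      case (Suc p)
      then have "D (p * L) + a < D (p * L + L)" using sign[OF step] True by simp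
      then show ?case using Suc by (simp add: add.commute)
    qed simp
    from this[of q] total q show False by simp
  next
    case False
    have "p \<le> q \<Longrightarrow> D (p * L) + p \<le> p * a" for p
    proof (induction p)
      case (Suc p)
      then have "\<not> D (p * L) + a < D (p * L + L)" using sign[OF step] False by simp
      moreover have "D (p * L + L) \<noteq> D (p * L) + a"
        by (rule no[OF step]) (use Suc.prems in simp)
      ultimately have "D (p * L + L) < D (p * L) + a" by simp
      then show ?case using Suc by (simp add: add.commute)
    qed (simp add: D0)
    from this[of q] total q show False by simp
  qed
qed

text \<open>The last clause quantifies over all colourings extending \<^term>\<open>C\<close>, since the final colours of
  the positions that are still on the stack or unread are not yet known.\<close>

definition stack_inv ::
  "(nat \<Rightarrow> nat) \<Rightarrow> nat \<Rightarrow> nat \<Rightarrow> nat \<Rightarrow> nat list \<Rightarrow> nat \<Rightarrow> nat \<Rightarrow> (nat \<Rightarrow> nat) \<Rightarrow> bool" where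
  "stack_inv h n L a stk i b C \<longleftrightarrow>
     distinct stk \<and> set stk \<subseteq> {..<i} \<and> i \<le> n \<and>
     length stk + b * L = i \<and> sum_list (map h stk) + b * a = (\<Sum>q<i. h q) \<and>
     (\<forall>q \<in> {..<i} - set stk. C q \<in> {1..b}) \<and>
     (\<forall>c\<in>{1..b}. card {q \<in> {..<i} - set stk. C q = c} = L \<and>
        sum h {q \<in> {..<i} - set stk. C q = c} = a) \<and>
     (\<forall>col :: nat \<Rightarrow> nat. (\<forall>q \<in> {..<i} - set stk. col q = C q) \<longrightarrow>
        padded_runs (map col [0..<n]) \<le> padded_runs (map col (stk @ [i..<n])) + 2 * b)"

lemma stack_inv_init: "stack_inv h n L a [] 0 0 C"
  by (simp add: stack_inv_def)

text \<open>Neither the set of assigned positions nor the list \<open>stk @ [i..<n]\<close> changes,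
  so the clauses on colours carry over verbatim.\<close>

lemma stack_inv_push:
  assumes "stack_inv h n L a stk i b C" "i < n"
  shows "stack_inv h n L a (stk @ [i]) (Suc i) b C"
proof -
  have eqs: "{..<Suc i} - set (stk @ [i]) = {..<i} - set stk" "(stk @ [i]) @ [Suc i..<n] = stk @ [i..<n]"
    using assms(2) by (auto simp: upt_conv_Cons)
  have "distinct stk" "set stk \<subseteq> {..<i}" "length stk + b * L = i"
    "sum_list (map h stk) + b * a = (\<Sum>q<i. h q)"
    using assms(1) unfolding stack_inv_def by blast+
  then have "distinct (stk @ [i])" "set (stk @ [i]) \<subseteq> {..<Suc i}" "length (stk @ [i]) + b * L = Suc i"
    "sum_list (map h (stk @ [i])) + b * a = (\<Sum>q<Suc i. h q)" "Suc i \<le> n"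
    using assms(2) by auto
  then show ?thesis
    using assms(1) unfolding stack_inv_def eqs by blast
qed

text \<open>The popped window is a block of the fresh colour \<open>Suc b\<close> inside
  \<open>(A @ W) @ [i..<n]\<close>; by \<open>padded_runs_insert_block\<close> its removal is paid
  by two runs.\<close>

lemma stack_inv_pop:
  assumes inv: "stack_inv h n L a (A @ W) i b C"
    and W: "length W = L" "sum_list (map h W) = a"
    and C': "\<And>q. q < i \<Longrightarrow> C' q = (if q \<in> set W then Suc b else C q)"
  shows "stack_inv h n L a A i (Suc b) C'"
proof -
  have i: "distinct (A @ W)" "set (A @ W) \<subseteq> {..<i}" "i \<le> n" "length (A @ W) + b * L = i"
    "sum_list (map h (A @ W)) + b * a = (\<Sum>q<i. h q)"
    and colours: "\<forall>q \<in> {..<i} - set (A @ W). C q \<in> {1..b}"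
    and classes: "\<forall>c\<in>{1..b}. card {q \<in> {..<i} - set (A @ W). C q = c} = L \<and>
        sum h {q \<in> {..<i} - set (A @ W). C q = c} = a"
    and bound: "\<forall>col :: nat \<Rightarrow> nat. (\<forall>q \<in> {..<i} - set (A @ W). col q = C q) \<longrightarrow>
        padded_runs (map col [0..<n]) \<le> padded_runs (map col ((A @ W) @ [i..<n])) + 2 * b"
    using inv unfolding stack_inv_def by blast+
  have dist: "distinct W" "set A \<inter> set W = {}" "set W \<subseteq> {..<i}" using i by auto
  have old: "q \<notin> set (A @ W)" "C' q = C q" "C q \<in> {1..b}" if "q < i" "q \<notin> set A" "q \<notin> set W" for q
    using that C' colours by auto
  have new: "C' q = Suc b" if "q \<in> set W" for q using that C' dist by auto
  have cls: "card {q \<in> {..<i} - set A. C' q = c} = L \<and>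
      sum h {q \<in> {..<i} - set A. C' q = c} = a" if "c \<in> {1..Suc b}" for c
  proof (cases "c = Suc b")
    case True
    \<comment> \<open>Earlier colours are at most \<open>b\<close>, so the class of
      \<open>Suc b\<close> is the window alone.\<close>
    have "{q \<in> {..<i} - set A. C' q = c} = set W"
    proof (intro equalityI subsetI)
      fix q assume q: "q \<in> {q \<in> {..<i} - set A. C' q = c}"
      show "q \<in> set W"
      proof (rule ccontr)
        assume "q \<notin> set W"
        with q old(2,3)[of q] True show False by auto
      qed
    qed (use new dist True in auto)
    then show ?thesis using W dist by (simp add: distinct_card sum_list_distinct_conv_sum_set)
  next
    case False
    then have "{q \<in> {..<i} - set A. C' q = c} = {q \<in> {..<i} - set (A @ W). C q = c}"
      using new C' by auto
    moreover have "c \<in> {1..b}" using that False by auto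
    ultimately show ?thesis using classes by simp
  qed
  have runs: "padded_runs (map col [0..<n]) \<le> padded_runs (map col (A @ [i..<n])) + 2 * Suc b"
    if col: "\<forall>q \<in> {..<i} - set A. col q = C' q" for col
  proof -
    have colW: "col q = Suc b" if "q \<in> set W" for q
    proof -
      have "q \<in> {..<i} - set A" using dist that by blast
      with col new[OF that] show ?thesis by simp
    qed
    \<comment> \<open>Agreeing with \<open>C'\<close> off \<open>A\<close> implies agreeing with
      \<open>C\<close> off \<open>A @ W\<close>, so the old bound applies to the same
      \<open>col\<close>.\<close>
    have "padded_runs (map col [0..<n]) \<le> padded_runs (map col ((A @ W) @ [i..<n])) + 2 * b"
      by (rule bound[rule_format]) (use col old in auto)
    also have "\<dots> \<le> padded_runs (map col (A @ [i..<n])) + 2 + 2 * b"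
      using padded_runs_insert_block[of "map col W" "Suc b" "map col A" "map col [i..<n]"] colW
      by auto
    finally show ?thesis by simp
  qed
  have "C' q \<in> {1..Suc b}" if "q \<in> {..<i} - set A" for q
    using old[of q] new[of q] that by fastforce
  moreover have "distinct A" "set A \<subseteq> {..<i}" "i \<le> n" "length A + Suc b * L = i"
    "sum_list (map h A) + Suc b * a = (\<Sum>q<i. h q)"
    using i W by simp_all
  ultimately show ?thesis
    using cls runs unfolding stack_inv_def by blast
qed

section \<open>The stack program\<close>

definition pop_prog :: com where
  "pop_prog = While (Less (Var ''r'') (Var ''s''))
     (Assign ''s'' (Minus (Var ''s'') (Const 1)) ;;
      Write ''C'' (Read ''S'' (Var ''s'')) (Var ''b''))"

lemma wp_pop_prog:
  fixes s
  defines "lo \<equiv> vars s ''r''" and "hi \<equiv> vars s ''s''" and "S \<equiv> arrays s ''S''"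
  assumes "lo \<le> hi"
  shows "wp I pop_prog (\<lambda>s' t'. vars s' ''s'' = lo \<and>
     (\<forall>q. arrays s' ''C'' q = (if q \<in> S ` {lo..<hi} then vars s ''b'' else arrays s ''C'' q)) \<and>
     t' \<le> t + 20 * (hi - lo) + 10) s t"
  unfolding pop_prog_def
proof (rule wp_While[where J = "\<lambda>s' t'. let p = vars s' ''s'' in lo \<le> p \<and> p \<le> hi \<and>
     (\<forall>q. arrays s' ''C'' q = (if q \<in> S ` {p..<hi} then vars s ''b'' else arrays s ''C'' q)) \<and>
     t' + 20 * p \<le> t + 20 * hi"
      and \<mu> = "\<lambda>s'. vars s' ''s''"], goal_cases)
  case 1
  show ?case using assms by (simp add: Let_def)
next
  case (2 s' t')
  have eq: "vars s' ''r'' = lo" "vars s' ''b'' = vars s ''b''" "arrays s' ''S'' = S"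
    using 2(3) by (simp_all add: framed_def lo_def S_def)
  define p where p: "p = vars s' ''s'' - 1"
  then have p': "vars s' ''s'' = Suc p" "lo \<le> p" "p < hi"
    using 2(1,2) eq by (auto simp: Let_def)
  have "{p..<hi} = insert p {Suc p..<hi}" using p' by auto
  then show ?case using 2(1) p' eq by (auto simp: Let_def)
next
  case (3 s' t')
  have "vars s' ''r'' = lo" using 3(3) by (simp add: framed_def lo_def)
  with 3(1,2) have "vars s' ''s'' = lo" by (simp add: Let_def)
  with 3(1) show ?case by (auto simp: Let_def)
qed

text \<open>$D[u]$ counts the group 1 points among the lowest $u$ stack entries.\<close>

definition window_test :: bexp where
  "window_test = Conj (Neg (Less (Var ''s'') (Var ''l'')))
     (Conj (Neg (Less (Read ''D'' (Var ''s''))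
                   (Plus (Read ''D'' (Minus (Var ''s'') (Var ''l''))) (Var ''a''))))
        (Neg (Less (Plus (Read ''D'' (Minus (Var ''s'') (Var ''l''))) (Var ''a''))
                   (Read ''D'' (Var ''s'')))))"

definition pop_step_prog :: com where
  "pop_step_prog = Cond window_test
     (incr ''b'' ;; Assign ''r'' (Minus (Var ''s'') (Var ''l'')) ;; pop_prog) Skip"

definition stack_prog :: com where
  "stack_prog = While (Less (Var ''i'') (Var ''n''))
     (Write ''S'' (Var ''s'') (Var ''i'') ;;
      Write ''D'' (Plus (Var ''s'') (Const 1))
        (Plus (Read ''D'' (Var ''s'')) (Minus (Const 2) (Group (Read ''order'' (Var ''i''))))) ;;
      incr ''s'' ;; incr ''i'' ;; pop_step_prog)"

text \<open>Both clauses on \<open>D\<close> speak only of heights up to \<open>p\<close>. A pop can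
  therefore just lower \<open>p\<close> and leave stale entries of \<open>S\<close> and
  \<open>D\<close> above it.\<close>

definition stack_state_inv :: "(nat \<Rightarrow> nat) \<Rightarrow> nat \<Rightarrow> nat \<Rightarrow> nat \<Rightarrow> nat \<Rightarrow> (nat \<Rightarrow> nat) \<Rightarrow> (nat \<Rightarrow> nat) \<Rightarrow>
    nat \<Rightarrow> nat \<Rightarrow> (nat \<Rightarrow> nat) \<Rightarrow> bool" where
  "stack_state_inv h n L a p S D i b C \<longleftrightarrow>
     stack_inv h n L a (map S [0..<p]) i b C \<and> (\<forall>u\<le>p. D u = (\<Sum>v<u. h (S v))) \<and>
     (\<forall>u. u + L \<le> p \<longrightarrow> D (u + L) \<noteq> D u + a)"

text \<open>The push creates one new window, the one ending at height \<open>Suc p\<close>. The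
  third conclusion leaves it open for the test that follows.\<close>

lemma stack_state_push:
  assumes "stack_state_inv h n L a p S D i b C" "i < n"
    and S': "S' = S(p := i)" and D': "D' = D(Suc p := D p + h i)"
  shows "stack_inv h n L a (map S' [0..<Suc p]) (Suc i) b C"
    and "\<And>u. u \<le> Suc p \<Longrightarrow> D' u = (\<Sum>v<u. h (S' v))"
    and "\<And>u. u + L \<le> p \<Longrightarrow> D' (u + L) \<noteq> D' u + a"
proof -
  have "map S' [0..<Suc p] = map S [0..<p] @ [i]" by (simp add: S')
  then show "stack_inv h n L a (map S' [0..<Suc p]) (Suc i) b C"
    using assms(1,2) stack_inv_push unfolding stack_state_inv_def by metis
next
  fix u assume u: "u \<le> Suc p"
  have eq: "(\<Sum>v<u. h (S' v)) = (\<Sum>v<u. h (S v))" if "u \<le> p" for u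
    by (rule sum.cong) (use that in \<open>auto simp: S'\<close>)
  show "D' u = (\<Sum>v<u. h (S' v))"
  proof (cases "u = Suc p")
    case True
    then show ?thesis using assms(1) eq[of p] by (simp add: D' S' stack_state_inv_def)
  next
    case False
    then show ?thesis using u assms(1) eq[of u] by (simp add: D' stack_state_inv_def)
  qed
next
  fix u assume "u + L \<le> p"
  then show "D' (u + L) \<noteq> D' u + a"
    using assms(1) by (auto simp: D' stack_state_inv_def)
qed

text \<open>Removing the popped windows leaves \<open>(M - b) * L\<close> entries with
  \<open>(M - b) * a\<close> group 1 points. For positive \<open>M - b\<close>,
  \<open>balanced_window\<close> contradicts the last clause of the invariant.\<close>

lemma stack_state_empty:
  assumes inv: "stack_state_inv h n L a p S D n b C"
    and h: "\<And>q. q < n \<Longrightarrow> h q \<le> 1" and L: "0 < L" and n: "n = M * L" and tot: "(\<Sum>q<n. h q) = M * a"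
  shows "p = 0 \<and> b = M"
proof -
  have len: "p + b * L = M * L" and sum: "sum_list (map h (map S [0..<p])) + b * a = M * a"
    and sub: "set (map S [0..<p]) \<subseteq> {..<n}"
    using inv tot n unfolding stack_state_inv_def stack_inv_def by auto
  have "b * L \<le> M * L" using len by linarith
  then have "b \<le> M" using L by simp
  have D: "D u = (\<Sum>v<u. h (S v))" if "u \<le> p" for u
    using inv that unfolding stack_state_inv_def by blast
  have p: "p = (M - b) * L" using len by (simp add: diff_mult_distrib)
  have "D p + b * a = M * a"
    using sum D[of p] by (simp add: interv_sum_list_conv_sum_set_nat lessThan_atLeast0 o_def)
  then have Dp: "D p = (M - b) * a" by (simp add: diff_mult_distrib)
  have "M - b = 0"
  proof (rule ccontr)
    assume "M - b \<noteq> 0"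
    moreover have "D u \<le> D (Suc u) \<and> D (Suc u) \<le> Suc (D u)" if "u < p" for u
    proof -
      have "S u < n" using sub that by force
      then show ?thesis using h[of "S u"] D[of u] D[of "Suc u"] that by simp
    qed
    ultimately obtain u where "u + L \<le> p" "D (u + L) = D u + a"
      using balanced_window[of D "M - b" L a] Dp p D[of 0] by auto
    then show False using inv unfolding stack_state_inv_def by blast
  qed
  with p \<open>b \<le> M\<close> show ?thesis by simp
qed

text \<open>An amortised bound: a pop costs 20 per removed entry, paid by the drop of 20 times the
  stack height; 80 covers the test and bookkeeping. \<open>no_window\<close> leaves out the top
  window, which the program tests.\<close>

lemma wp_pop_step_prog:
  fixes s
  defines "S \<equiv> arrays s ''S''" and "D \<equiv> arrays s ''D''" and "p \<equiv> vars s ''s''" and "b \<equiv> vars s ''b''"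
    and "L \<equiv> vars s ''l''" and "a \<equiv> vars s ''a''"
  assumes inv: "stack_inv h n L a (map S [0..<p]) i b (arrays s ''C'')"
    and sums: "\<And>u. u \<le> p \<Longrightarrow> D u = (\<Sum>v<u. h (S v))"
    and no_window: "\<And>u. u + L < p \<Longrightarrow> D (u + L) \<noteq> D u + a"
    and L: "0 < L"
  shows "wp I pop_step_prog (\<lambda>s' t'.
     stack_state_inv h n L a (vars s' ''s'') S D i (vars s' ''b'') (arrays s' ''C'') \<and>
     t' + 20 * vars s' ''s'' \<le> t + 80 + 20 * p) s t"
proof (cases "L \<le> p \<and> D p = D (p - L) + a")
  case True
  then have guard: "bval I s window_test"
    by (auto simp: window_test_def S_def D_def p_def L_def a_def)
  define r where "r = p - L"
  have rL: "r + L = p" using True by (simp add: r_def)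
  show ?thesis
    unfolding pop_step_prog_def wp_Cond if_P[OF guard] wp_Seq wp_Assign
  proof (rule wp_consequence[OF wp_pop_prog], goal_cases)
    case 1
    show ?case by simp
  next
    case (2 s' t')
    have post: "vars s' ''s'' = r" "vars s' ''b'' = Suc b"
      "\<forall>q. arrays s' ''C'' q = (if q \<in> S ` {r..<p} then Suc b else arrays s ''C'' q)"
      "t' \<le> t + 50 + 20 * L"
      using 2 rL by (auto simp: framed_def pop_prog_def r_def p_def b_def L_def S_def window_test_def)
    have C: "arrays s' ''C'' q = (if q \<in> set (map S [r..<p]) then Suc b else arrays s ''C'' q)" for q
      unfolding set_map set_upt using post(3) by blast
    have "[0..<p] = [0..<r] @ [r..<p]"
      using upt_add_eq_append[of 0 r L] rL by simp
    then have split: "map S [0..<p] = map S [0..<r] @ map S [r..<p]"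
      by simp
    have "D p = D r + (\<Sum>v\<in>{r..<p}. h (S v))"
      using sums[of p] sums[of r] sum.atLeastLessThan_concat[of 0 r p "\<lambda>v. h (S v)"] rL
      by (simp add: lessThan_atLeast0)
    then have "sum_list (map h (map S [r..<p])) = a"
      using True by (simp add: interv_sum_list_conv_sum_set_nat o_def r_def)
    then have "stack_inv h n L a (map S [0..<r]) i (Suc b) (arrays s' ''C'')"
      by (rule stack_inv_pop[OF inv[unfolded split] _ _ C, rotated]) (use rL in auto)
    \<comment> \<open>One pop suffices: as \<open>L\<close> is positive, a window inside the lowest
      \<open>r\<close> entries ends strictly below \<open>p\<close> and falls under
      \<open>no_window\<close>.\<close>
    then have "stack_state_inv h n L a r S D i (Suc b) (arrays s' ''C'')"
      unfolding stack_state_inv_def using sums no_window rL L by simp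
    then show ?case using post rL by simp
  qed
next
  case False
  then have guard: "\<not> bval I s window_test"
    by (auto simp: window_test_def S_def D_def p_def L_def a_def)
  have "D (u + L) \<noteq> D u + a" if "u + L \<le> p" for u
  proof (cases "u + L = p")
    case True
    with False show ?thesis by auto
  qed (use no_window that in simp)
  then have "stack_state_inv h n L a p S D i b (arrays s ''C'')"
    unfolding stack_state_inv_def using inv sums by blast
  then show ?thesis
    unfolding pop_step_prog_def wp_Cond if_not_P[OF guard] wp_Skip
    by (simp add: p_def b_def window_test_def)
qed

lemma wp_stack_prog:
  fixes s I
  defines "n \<equiv> vars s ''n''" and "L \<equiv> vars s ''l''" and "a \<equiv> vars s ''a''"
    and "h \<equiv> \<lambda>q. 2 - grp I (arrays s ''order'' q)"
  assumes start: "vars s ''i'' = 0" "vars s ''s'' = 0" "vars s ''b'' = 0" "arrays s ''D'' 0 = 0"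
    and h: "\<And>q. q < n \<Longrightarrow> h q \<le> 1" and L: "0 < L" and n: "n = M * L" and tot: "(\<Sum>q<n. h q) = M * a"
  shows "wp I stack_prog (\<lambda>s' t'. stack_inv h n L a [] n M (arrays s' ''C'') \<and>
     t' \<le> t + 200 * n + 10) s t"
  unfolding stack_prog_def
proof (rule wp_While[where J = "\<lambda>s' t'. vars s' ''i'' \<le> n \<and>
      stack_state_inv h n L a (vars s' ''s'') (arrays s' ''S'') (arrays s' ''D'') (vars s' ''i'')
        (vars s' ''b'') (arrays s' ''C'') \<and> t' + 20 * vars s' ''s'' \<le> t + 200 * vars s' ''i''"
      and \<mu> = "\<lambda>s'. n - vars s' ''i''"], goal_cases)
  case 1
  show ?case using start stack_inv_init L by (simp add: stack_state_inv_def)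
next
  case (2 s' t')
  have eq: "vars s' ''n'' = n" "vars s' ''l'' = L" "vars s' ''a'' = a"
      "arrays s' ''order'' = arrays s ''order''"
    using 2(3) by (simp_all add: framed_def n_def L_def a_def pop_step_prog_def pop_prog_def)
  define p i b where d: "p = vars s' ''s''" "i = vars s' ''i''" "b = vars s' ''b''"
  define S D where S: "S = (arrays s' ''S'')(p := i)"
    and D: "D = (arrays s' ''D'')(Suc p := arrays s' ''D'' p + h i)"
  have i: "i < n" using 2(2) eq d by simp
  have time: "t' + 20 * p \<le> t + 200 * i" using 2(1) d by simp
  have old: "stack_state_inv h n L a p (arrays s' ''S'') (arrays s' ''D'') i b (arrays s' ''C'')"
    using 2(1) d by simp
  note push = stack_state_push[OF old i S D]
  show ?case
    unfolding wp_Seq wp_Assign wp_Write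
  proof (rule wp_consequence[OF wp_pop_step_prog[where h = h and n = n and i = "Suc i"]], goal_cases)
    case 1
    then show ?case using push(1) by (simp add: eq d[symmetric] S h_def del: upt_Suc)
  next
    case (2 u)
    then show ?case using push(2)[of u] by (simp add: eq d[symmetric] S D h_def)
  next
    case (3 u)
    then show ?case using push(3)[of u] by (simp add: eq d[symmetric] S D h_def)
  next
    case 4
    then show ?case using L by (simp add: eq)
  next
    case (5 s1 t1)
    have "vars s1 ''i'' = Suc i" "arrays s1 ''S'' = S" "arrays s1 ''D'' = D"
      using 5(2) by (simp_all add: framed_def pop_step_prog_def pop_prog_def eq d S D h_def)
    then show ?case
      using 5(1) time i by (simp add: eq d[symmetric] S D h_def)
  qed
next
  case (3 s' t')
  have "vars s' ''n'' = n" using 3(3) by (simp add: framed_def n_def pop_step_prog_def pop_prog_def)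
  with 3(1,2) have i: "vars s' ''i'' = n" by simp
  with 3(1) have *: "stack_state_inv h n L a (vars s' ''s'') (arrays s' ''S'') (arrays s' ''D'') n
        (vars s' ''b'') (arrays s' ''C'')" by simp
  have "vars s' ''s'' = 0 \<and> vars s' ''b'' = M"
    by (rule stack_state_empty[OF * h L n tot])
  with * 3(1) i show ?case by (simp add: stack_state_inv_def)
qed

section \<open>Boundaries from colours\<close>

text \<open>Equality is expressed by two negated \<open>Less\<close>. Bin 0 has no boundary on its
  left, so the boundary stored at index \<open>k\<close> opens bin \<open>k + 1\<close>; hence
  \<open>k\<close> is incremented before \<open>assign\<close> is written.\<close>

definition bounds_prog :: com where
  "bounds_prog = Write ''assign'' (Const 0) (Read ''C'' (Const 0)) ;; Assign ''i'' (Const 1) ;;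
     While (Less (Var ''i'') (Var ''n''))
       (Cond (Conj (Neg (Less (Read ''C'' (Minus (Var ''i'') (Const 1))) (Read ''C'' (Var ''i''))))
                   (Neg (Less (Read ''C'' (Var ''i'')) (Read ''C'' (Minus (Var ''i'') (Const 1))))))
          Skip
          (Write ''boundaries'' (Var ''k'') (Var ''i'') ;; incr ''k'' ;;
           Write ''assign'' (Var ''k'') (Read ''C'' (Var ''i''))) ;;
        incr ''i'')"

definition colour_changes :: "(nat \<Rightarrow> nat) \<Rightarrow> nat \<Rightarrow> nat list" where
  "colour_changes C n = filter (\<lambda>q. C (q - 1) \<noteq> C q) [1..<n]"

text \<open>The argument of \<open>f\<close> in the first clause is the bin index used by
  \<open>bin\<close>. The second clause supplies what \<open>cut_based\<close> asks for, a
  legitimate bucket for every bin.\<close>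

definition bin_colours :: "(nat \<Rightarrow> nat) \<Rightarrow> nat \<Rightarrow> (nat \<Rightarrow> nat) \<Rightarrow> bool" where
  "bin_colours C n f \<longleftrightarrow>
     (\<forall>u<n. f (length (filter (\<lambda>q. q \<le> u) (colour_changes C n))) = C u) \<and>
     (\<forall>q \<le> length (colour_changes C n). f q \<in> C ` {..<n})"

lemma colour_changes_Suc:
  "1 \<le> n \<Longrightarrow> colour_changes C (Suc n) = colour_changes C n @ (if C (n - 1) \<noteq> C n then [n] else [])"
  by (simp add: colour_changes_def)

lemma filter_le_colour_changes:
  "n \<le> Suc u \<Longrightarrow> filter (\<lambda>q. q \<le> u) (colour_changes C n) = colour_changes C n"
  by (rule filter_True) (auto simp: colour_changes_def)

lemma bin_colours_same:
  assumes "bin_colours C n f" "1 \<le> n" "C (n - 1) = C n"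
  shows "bin_colours C (Suc n) f"
proof -
  have "f (length (colour_changes C n)) = C n"
    using assms filter_le_colour_changes[of n "n - 1" C] unfolding bin_colours_def
    by (metis diff_less le_SucI less_numeral_extra(1) Suc_diff_1 less_le_trans order_refl)
  then show ?thesis
    using assms unfolding bin_colours_def colour_changes_Suc[OF assms(2)]
    by (auto simp: less_Suc_eq filter_le_colour_changes)
qed

text \<open>The index written lies beyond the bin indices of all earlier positions, so their buckets
  survive the update.\<close>

lemma bin_colours_change:
  assumes "bin_colours C n f" "1 \<le> n" "C (n - 1) \<noteq> C n"
  shows "bin_colours C (Suc n) (f(Suc (length (colour_changes C n)) := C n))"
proof -
  have "length (filter (\<lambda>q. q \<le> u) (colour_changes C n)) \<noteq> Suc (length (colour_changes C n))" for u
    using length_filter_le[of "\<lambda>q. q \<le> u" "colour_changes C n"] by linarith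
  then show ?thesis
    using assms unfolding bin_colours_def colour_changes_Suc[OF assms(2)]
    by (auto simp: less_Suc_eq filter_le_colour_changes le_Suc_eq)
qed

lemma wp_bounds_prog:
  fixes s
  defines "C \<equiv> arrays s ''C''" and "n \<equiv> vars s ''n''"
  assumes "vars s ''k'' = 0" "1 \<le> n"
  shows "wp I bounds_prog (\<lambda>s' t'.
     map (arrays s' ''boundaries'') [0..<vars s' ''k''] = colour_changes C n \<and>
     bin_colours C n (arrays s' ''assign'') \<and> t' \<le> t + 50 * n + 50) s t"
  unfolding bounds_prog_def wp_Seq wp_Assign wp_Write
proof (rule wp_While[where J = "\<lambda>s' t'. let i = vars s' ''i'' in 1 \<le> i \<and> i \<le> n \<and>
      map (arrays s' ''boundaries'') [0..<vars s' ''k''] = colour_changes C i \<and>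
      bin_colours C i (arrays s' ''assign'') \<and> t' \<le> t + 20 + 50 * i"
      and \<mu> = "\<lambda>s'. n - vars s' ''i''"], goal_cases)
  case 1
  show ?case using assms by (simp add: Let_def colour_changes_def bin_colours_def)
next
  case (2 s' t')
  define i k where d: "i = vars s' ''i''" "k = vars s' ''k''"
  have eq: "vars s' ''n'' = n" "arrays s' ''C'' = C"
    using 2(3) by (simp_all add: framed_def n_def C_def)
  have J: "1 \<le> i" "map (arrays s' ''boundaries'') [0..<k] = colour_changes C i"
    "bin_colours C i (arrays s' ''assign'')" "t' \<le> t + 20 + 50 * i" and i: "i < n"
    using 2(1,2) eq d by (simp_all add: Let_def)
  have k: "k = length (colour_changes C i)" using arg_cong[OF J(2), of length] by simp
  show ?case
  proof (cases "C (i - 1) = C i")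
    case True
    then show ?thesis
      using J i bin_colours_same[OF J(3,1) True] colour_changes_Suc[OF J(1), of C]
      by (simp add: d[symmetric] eq Let_def)
  next
    case False
    have "map ((arrays s' ''boundaries'')(k := i)) [0..<Suc k] = colour_changes C (Suc i)"
      using J(2) False colour_changes_Suc[OF J(1), of C] by simp
    then show ?thesis
      using J i False bin_colours_change[OF J(3,1) False]
      by (auto simp add: d[symmetric] k[symmetric] eq Let_def simp del: upt_Suc)
  qed
next
  case (3 s' t')
  have "vars s' ''n'' = n" using 3(3) by (simp add: framed_def n_def)
  with 3(1,2) show ?case by (auto simp: Let_def)
qed

section \<open>The hashmap of a balanced colouring\<close>

lemma card_nth_image_group:
  assumes "distinct xs" "A \<subseteq> {..<length xs}" and g: "\<forall>p\<in>set xs. g p \<in> {1, 2}"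
  shows "card {p \<in> (!) xs ` A. g p = 1} = (\<Sum>q\<in>A. 2 - g (xs ! q))"
proof -
  have fin: "finite A" using assms(2) finite_subset by blast
  have "{p \<in> (!) xs ` A. g p = 1} = (!) xs ` {q \<in> A. g (xs ! q) = 1}" by auto
  moreover have "inj_on ((!) xs) {q \<in> A. g (xs ! q) = 1}"
    using assms by (intro inj_on_nth) auto
  ultimately have "card {p \<in> (!) xs ` A. g p = 1} = (\<Sum>q\<in>{q \<in> A. g (xs ! q) = 1}. 1)"
    by (simp add: card_image)
  also have "\<dots> = (\<Sum>q\<in>A. if g (xs ! q) = 1 then 1 else 0)"
    by (rule sum.inter_filter[OF fin])
  also have "\<dots> = (\<Sum>q\<in>A. 2 - g (xs ! q))"
  proof (rule sum.cong)
    fix q assume "q \<in> A"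
    then have "g (xs ! q) \<in> {1, 2}" using assms by (intro bspec[OF g] nth_mem) auto
    then show "(if g (xs ! q) = 1 then 1 else 0) = 2 - g (xs ! q)" by auto
  qed simp
  finally show ?thesis .
qed

definition balanced_colouring ::
  "(nat \<Rightarrow> nat) \<Rightarrow> nat \<Rightarrow> nat \<Rightarrow> nat \<Rightarrow> nat \<Rightarrow> (nat \<Rightarrow> nat) \<Rightarrow> bool" where
  "balanced_colouring h n L a m C \<longleftrightarrow> (\<forall>q<n. C q \<in> {1..m}) \<and>
     (\<forall>j\<in>{1..m}. card {q \<in> {..<n}. C q = j} = L \<and> sum h {q \<in> {..<n}. C q = j} = a) \<and>
     length (colour_changes C n) \<le> 2 * (m - 1)"

lemma balanced_colouring_cong:
  assumes "\<And>q. q < n \<Longrightarrow> h q = h' q"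
  shows "balanced_colouring h n L a m C \<longleftrightarrow> balanced_colouring h' n L a m C"
proof -
  have "sum h {q \<in> {..<n}. C q = j} = sum h' {q \<in> {..<n}. C q = j}" for j
    by (rule sum.cong) (use assms in auto)
  then show ?thesis unfolding balanced_colouring_def by simp
qed

text \<open>With nothing on the stack or unread, the run bound for \<open>col = C\<close> says that
  the number of changes plus 2 is at most \<open>2 * m\<close>: one unit is the padding, the other
  the excess of runs over changes.\<close>

lemma stack_inv_balanced:
  assumes "stack_inv h n L a [] n m C" "0 < n"
  shows "balanced_colouring h n L a m C"
proof -
  have "\<forall>q \<in> {..<n} - set []. C q \<in> {1..m}"
    and "\<forall>j\<in>{1..m}. card {q \<in> {..<n} - set []. C q = j} = L \<and> sum h {q \<in> {..<n} - set []. C q = j} = a"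
    and "padded_runs (map C [0..<n]) \<le> padded_runs (map C ([] @ [n..<n])) + 2 * m"
    using assms(1) unfolding stack_inv_def by blast+
  moreover obtain n' where "n = Suc n'" using assms(2) by (cases n) auto
  ultimately show ?thesis
    using length_remdups_adj_upt[of C n'] unfolding balanced_colouring_def
    by (simp add: padded_runs_def colour_changes_def del: upt_Suc)
qed

text \<open>Once both groups are counted, every ratio and share is \<open>1 / m\<close>, so
  unfairness, collision probability and single fairness are all sums of \<open>m\<close> terms
  \<open>(1 / m)\<^sup>2\<close>.\<close>

lemma balanced_hashmap:
  fixes P :: "'p set" and ys :: "'p list"
  assumes ys: "distinct ys" "set ys = P" "sorted (map x ys)" "length ys = n"
    and g: "\<forall>p\<in>P. g p \<in> {1, 2}"
    and ne: "group_of P g 1 \<noteq> {}" "group_of P g 2 \<noteq> {}" and m: "m \<ge> 1"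
    and n: "n = m * L" and c1: "card (group_of P g 1) = m * a"
    and inv: "balanced_colouring (\<lambda>q. 2 - g (ys ! q)) n L a m C"
    and f: "bin_colours C n f"
  defines "H \<equiv> Hashmap ys (colour_changes C n) f"
  shows "eps_alpha_hashmap 0 2 P x g m H" (is ?eps)
    and "length (boundaries H) \<le> 2 * (m - 1)" (is ?len)
    and "\<forall>i\<in>{1, 2}. \<forall>j\<in>{1..m}.
       real (group_count P g H i j) = real (card (group_of P g i)) / real m" (is ?count)
    and "collision_probability P m H = 1 / real m" (is ?coll)
    and "\<forall>i\<in>{1, 2}. single_fairness P g m H i = 1 / real m" (is ?fair)
proof -
  have fin: "finite P" and P: "card P = n"
    using ys distinct_card by auto
  have colours: "C q \<in> {1..m}" if "q < n" for q
    using inv that unfolding balanced_colouring_def by blast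
  have classes: "card {q \<in> {..<n}. C q = j} = L" "(\<Sum>q\<in>{q \<in> {..<n}. C q = j}. 2 - g (ys ! q)) = a"
    if "j \<in> {1..m}" for j
    using inv that unfolding balanced_colouring_def by blast+
  have npos: "0 < n" using ne fin unfolding P[symmetric] group_of_def by (auto simp: card_gt_0_iff)
  have len: "length (colour_changes C n) \<le> 2 * (m - 1)"
    using inv unfolding balanced_colouring_def by blast
  then show ?len by (simp add: H_def)
  define bn where "bn q = length (filter (\<lambda>b. b \<le> q) (boundaries H))" for q
  have bn: "assign H (bn q) = C q" "bn q \<le> length (boundaries H)" if "q < n" for q
    using f that unfolding bin_colours_def H_def bn_def by simp_all
  have bins: "bin H k = {ys ! i |i. i < n \<and> bn i = k}" for k
    unfolding bin_def bn_def using ys(4) by (simp add: H_def)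
  \<comment> \<open>\<open>assign\<close> sends the bin of position \<open>q\<close> to
    \<open>C q\<close>, so a bucket is a colour class, however many bins it consists of.\<close>
  have bucket: "bucket H j = (!) ys ` {q \<in> {..<n}. C q = j}" for j
  proof (intro equalityI subsetI)
    fix p assume "p \<in> (!) ys ` {q \<in> {..<n}. C q = j}"
    then obtain q where "q < n" "C q = j" "p = ys ! q" by auto
    with bn[of q] bins show "p \<in> bucket H j"
      unfolding bucket_def by (intro UN_I[of "bn q"]) auto
  next
    fix p assume "p \<in> bucket H j"
    then obtain k where "assign H k = j" "p \<in> bin H k" unfolding bucket_def by auto
    then show "p \<in> (!) ys ` {q \<in> {..<n}. C q = j}" using bins bn(1) by auto
  qed
  have card_bucket: "card (bucket H j) = L" if "j \<in> {1..m}" for j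
    using classes(1)[OF that] unfolding bucket
    by (subst card_image) (auto intro!: inj_on_nth ys simp: ys(4))
  have count1: "group_count P g H 1 j = a" if "j \<in> {1..m}" for j
  proof -
    have "group_of P g 1 \<inter> bucket H j = {p \<in> (!) ys ` {q \<in> {..<n}. C q = j}. g p = 1}"
      unfolding bucket group_of_def using ys by auto
    moreover have "card {p \<in> (!) ys ` {q \<in> {..<n}. C q = j}. g p = 1} = a"
      unfolding classes(2)[OF that, symmetric] by (rule card_nth_image_group) (use ys g in auto)
    ultimately show ?thesis
      unfolding group_count_def by simp
  qed
  have bucketP: "bucket H j \<subseteq> P" for j
    unfolding bucket using ys by auto
  have count2: "group_count P g H 2 j = L - a" if "j \<in> {1..m}" for j
  proof -
    have "group_of P g 2 \<inter> bucket H j = bucket H j - group_of P g 1 \<inter> bucket H j"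
      unfolding group_of_def using bucketP[of j] g by auto
    moreover have "card (bucket H j - group_of P g 1 \<inter> bucket H j) = L - a"
      using card_bucket[OF that] count1[OF that] finite_subset[OF bucketP fin]
      unfolding group_count_def by (subst card_Diff_subset) auto
    ultimately show ?thesis unfolding group_count_def by simp
  qed
  have "group_of P g 2 = P - group_of P g 1"
    using g unfolding group_of_def by auto
  moreover have "card (P - group_of P g 1) = n - m * a"
    using c1 fin P unfolding group_of_def by (subst card_Diff_subset) auto
  ultimately have c2: "card (group_of P g 2) = m * (L - a)"
    by (simp add: n diff_mult_distrib2)
  have pos: "0 < card (group_of P g i)" if "i \<in> {1, 2}" for i
    using that ne fin unfolding group_of_def by (auto simp: card_gt_0_iff)
  show count: ?count
    using count1 count2 c1 c2 m by auto
  have ratio: "real (group_count P g H i j) / real (card (group_of P g i)) = 1 / real m"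
    if "i \<in> {1, 2}" "j \<in> {1..m}" for i j
    using bspec[OF bspec[OF count that(1)] that(2)] pos[OF that(1)] by simp
  have share: "real (card (bucket H j)) / real (card P) = 1 / real m" if "j \<in> {1..m}" for j
    using card_bucket[OF that] npos by (simp add: P n)
  have sq: "(\<Sum>j = 1..m. (1 / real m)\<^sup>2) = 1 / real m"
    using m by (simp add: power2_eq_square)
  show ?coll
    unfolding collision_probability_def using share sq by simp
  show ?fair
    unfolding single_fairness_def using share ratio sq by (simp add: power2_eq_square)
  have "(\<Sum>j = 1..m. (real (group_count P g H i j) / real (card (group_of P g i)))\<^sup>2) = 1 / real m"
    if "i \<in> {1, 2}" for i
    using ratio[OF that] sq by simp
  then have "eps_unfair 0 P g m H"
    unfolding eps_unfair_def by simp
  moreover have "alpha_memory 2 m H"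
    using len m unfolding alpha_memory_def by (simp add: H_def of_nat_diff)
  moreover have "cut_based P x m H"
    unfolding cut_based_def
  proof (intro conjI allI impI)
    fix k assume "k \<le> length (boundaries H)"
    then have "f k \<in> C ` {..<n}" using f unfolding bin_colours_def H_def by simp
    then show "assign H k \<in> {1..m}" using colours by (auto simp: H_def)
  qed (use ys P in \<open>auto simp: H_def colour_changes_def intro: sorted_wrt_filter\<close>)
  ultimately show ?eps
    unfolding eps_alpha_hashmap_def by blast
qed

section \<open>The composed program and its running time\<close>

definition hashmap_prog :: com where
  "hashmap_prog = init_prog ;; div_prog ;; sort_prog ;; Assign ''i'' (Const 0) ;; stack_prog ;; bounds_prog"

text \<open>The linear term adds \<open>60 * n\<close> for initialization and division,
  \<open>200 * n\<close> for the stack and \<open>50 * n\<close> for the boundaries.\<close>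

lemma wp_hashmap_prog:
  fixes I n m L a
  defines "s \<equiv> initial_state n m"
  assumes grp: "\<And>i. i < n \<Longrightarrow> grp I i \<in> {1, 2}"
    and m: "1 \<le> m" and n: "n = m * L" "0 < n" and c1: "(\<Sum>i<n. 2 - grp I i) = m * a"
  shows "wp I hashmap_prog (\<lambda>s' t'.
     \<exists>C. (\<forall>u v. u < v \<and> v < n \<longrightarrow> key I (arrays s' ''order'' u) \<le> key I (arrays s' ''order'' v)) \<and>
       arrays s' ''order'' ` {..<n} = {..<n} \<and>
       balanced_colouring (\<lambda>q. 2 - grp I (arrays s' ''order'' q)) n L a m C \<and>
       map (arrays s' ''boundaries'') [0..<vars s' ''k''] = colour_changes C n \<and>
       bin_colours C n (arrays s' ''assign'') \<and>
       (\<exists>r. 2 ^ r \<le> 2 * n \<and> t' \<le> 300 * n * r + 310 * n + 150)) s 0"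
  unfolding hashmap_prog_def wp_Seq wp_Assign
proof (rule wp_consequence[OF wp_init_prog], goal_cases)
  case (3 s1 t1)
  have s: "vars s v = (if v = ''n'' then n else if v = ''m'' then m else 0)" "arrays s b u = 0" for v b u
    by (simp_all add: s_def initial_state_def)
  have s1: "vars s1 v = vars s v" if "v \<notin> {''i'', ''c''}" for v
    using framed_vars[OF 3(2), of v] that by (simp add: init_prog_def)
  have a1: "arrays s1 b = arrays s b" if "b \<noteq> ''order''" for b
    using framed_arrays[OF 3(2), of b] that by (simp add: init_prog_def)
  have q1: "\<forall>i<n. arrays s1 ''order'' i = i" "vars s1 ''c'' = m * a" "t1 \<le> 20 * n + 10"
    using 3(1) c1 by (simp_all add: s)
  have Lpos: "0 < L" using n by simp
  \<comment> \<open>Each indicator is at most 1, so \<open>a \<le> L\<close>; this bounds the second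
    division loop by \<open>n\<close> iterations.\<close>
  have "m * a \<le> (\<Sum>i<n. 1)"
    unfolding c1[symmetric] by (rule sum_mono) (use grp in fastforce)
  then have aL: "a \<le> L" using m n by simp
  show ?case
  proof (rule wp_consequence[OF wp_div_prog[where L = L and a = a]], goal_cases)
    case (8 s2 t2)
    have s2: "vars s2 v = vars s v" if "v \<notin> {''i'', ''c'', ''x'', ''y'', ''l'', ''a''}" for v
      using framed_vars[OF 8(2), of v] s1 that by (simp add: div_prog_def)
    have a2: "arrays s2 b = arrays s1 b" for b
      using framed_arrays[OF 8(2), of b] by (simp add: div_prog_def)
    have q2: "vars s2 ''l'' = L" "vars s2 ''a'' = a" "t2 \<le> 60 * n + 30"
    proof -
      have "L \<le> n" using n m by simp
      then show "t2 \<le> 60 * n + 30" using 8(1) q1 aL by linarith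
    qed (use 8(1) in simp_all)
    show ?case
    proof (rule wp_consequence[OF wp_sort_prog], goal_cases)
      case (3 s3 t3)
      have s3: "vars s3 v = vars s2 v" if "v \<notin> {''w'', ''o'', ''i'', ''p'', ''q'', ''j'', ''e''}" for v
        using framed_vars[OF 3(2), of v] that
        by (simp add: sort_prog_def pass_prog_def merge_prog_def copy_prog_def)
      have a3: "arrays s3 b = arrays s1 b" if "b \<notin> {''order'', ''B''}" for b
        using framed_arrays[OF 3(2), of b] that a2
        by (simp add: sort_prog_def pass_prog_def merge_prog_def copy_prog_def)
      define Or where "Or = arrays s3 ''order''"
      obtain r where q3: "\<forall>u v. u < v \<and> v < n \<longrightarrow> key I (Or u) \<le> key I (Or v)"
        "Or ` {..<n} = {..<n}" and r: "2 ^ r \<le> 2 * n" "t3 \<le> t2 + 300 * n * r + 20"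
        using 3(1) by (auto simp: s2 s Or_def)
      \<comment> \<open>A surjection of a finite set onto itself is injective, so sorting preserves
        the group 1 total.\<close>
      have "inj_on Or {..<n}"
        by (rule finite_surj_inj) (use q3(2) in auto)
      then have "(\<Sum>q<n. 2 - grp I (Or q)) = (\<Sum>q\<in>Or ` {..<n}. 2 - grp I q)"
        by (simp add: sum.reindex)
      then have tot: "(\<Sum>q<n. 2 - grp I (Or q)) = m * a"
        by (simp add: q3(2) c1)
      have grpO: "2 - grp I (Or q) \<le> 1" if "q < n" for q
        using grp[of "Or q"] q3(2) that by fastforce
      show ?case
      proof (rule wp_consequence[OF wp_stack_prog[where M = m]], goal_cases)
        case (9 s4 t4)
        have s4: "vars s4 v = vars s3 v" if "v \<notin> {''s'', ''i'', ''b'', ''r''}" for v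
          using framed_vars[OF 9(2), of v] that
          by (simp add: stack_prog_def pop_step_prog_def pop_prog_def)
        have a4: "arrays s4 b = arrays s3 b" if "b \<notin> {''S'', ''D'', ''C''}" for b
          using framed_arrays[OF 9(2), of b] that
          by (simp add: stack_prog_def pop_step_prog_def pop_prog_def)
        define C where "C = arrays s4 ''C''"
        have q4: "balanced_colouring (\<lambda>q. 2 - grp I (Or q)) n L a m C" "t4 \<le> t3 + 2 + 200 * n + 10"
          using 9(1) n by (auto simp: s3 s2 s q2 Or_def C_def intro!: stack_inv_balanced)
        show ?case
        proof (rule wp_consequence[OF wp_bounds_prog], goal_cases)
          case (3 s5 t5)
          have "arrays s5 ''order'' = Or"
            using framed_arrays[OF 3(2), of "''order''"] by (simp add: bounds_prog_def a4 Or_def)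
          then show ?case
            using 3(1) q3 q4 r q2 by (intro exI[of _ C]) (auto simp: s4 s3 s2 s C_def intro!: exI[of _ r])
        qed (use n in \<open>simp_all add: s4 s3 s2 s\<close>)
      qed (use tot grpO Lpos n a1 in \<open>simp_all add: s3 s2 s q2 a3 Or_def[symmetric]\<close>)
    qed (use n q1 in \<open>simp_all add: s2 s a2\<close>)
  qed (use m n q1 in \<open>simp_all add: s1 s\<close>)
qed (simp_all add: s_def initial_state_def)

theorem theorem4p3:
  "\<exists>(c :: com) (T :: nat \<Rightarrow> nat).
     (\<lambda>n. real (T n)) \<in> O(\<lambda>n. real n * ln (real n)) \<and>
     (\<forall>(P :: 'p set) (ps :: 'p list) (x :: 'p \<Rightarrow> real) (g :: 'p \<Rightarrow> nat) (n :: nat) (m :: nat).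
        set ps = P \<and> distinct ps \<and> card P = n \<and>
        (\<forall>p\<in>P. g p \<in> {1, 2}) \<and>
        group_of P g 1 \<noteq> {} \<and> group_of P g 2 \<noteq> {} \<and>
        m \<ge> 1 \<and> m dvd card (group_of P g 1) \<and> m dvd card (group_of P g 2) \<longrightarrow>
        (\<exists>t s H. exec (point_input ps x g) c (initial_state n m) t s \<and> t \<le> T n \<and>
           H = output_hashmap ps s \<and>
           eps_alpha_hashmap 0 2 P x g m H \<and>
           length (boundaries H) \<le> 2 * (m - 1) \<and>
           (\<forall>i\<in>{1, 2}. \<forall>j\<in>{1..m}.
              real (group_count P g H i j) = real (card (group_of P g i)) / real m) \<and>
           collision_probability P m H = 1 / real m \<and>
           (\<forall>i\<in>{1, 2}. single_fairness P g m H i = 1 / real m)))"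
proof -
  \<comment> \<open>\<open>F\<close> is the bound of \<open>wp_hashmap_prog\<close> with
    \<open>r\<close> replaced by \<open>log 2 (2 * n)\<close>, that is
    \<open>1 + ln n / ln 2\<close>; \<open>T\<close> rounds it down, which is harmless for natural
    step counts.\<close>
  define F :: "nat \<Rightarrow> real" where "F n = 300 * n * (1 + ln n / ln 2) + 310 * n + 150" for n
  define T where "T n = nat \<lfloor>F n\<rfloor>" for n
  have Fpos: "0 \<le> F n" for n
    by (cases "n = 0") (auto simp: F_def intro!: add_nonneg_nonneg mult_nonneg_nonneg)
  have "(\<lambda>n. real (T n)) \<in> O(F)"
  proof (rule bigoI[of _ 1], rule always_eventually, rule allI)
    fix n show "norm (real (T n)) \<le> 1 * norm (F n)"
      using Fpos[of n] by (simp add: T_def)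
  qed
  also have "F \<in> O(\<lambda>n. real n * ln (real n))"
    unfolding F_def by real_asymp
  finally have bigo: "(\<lambda>n. real (T n)) \<in> O(\<lambda>n. real n * ln (real n))" .
  have main: "\<exists>t s H. exec (point_input ps x g) hashmap_prog (initial_state n m) t s \<and> t \<le> T n \<and>
           H = output_hashmap ps s \<and>
           eps_alpha_hashmap 0 2 P x g m H \<and>
           length (boundaries H) \<le> 2 * (m - 1) \<and>
           (\<forall>i\<in>{1, 2}. \<forall>j\<in>{1..m}.
              real (group_count P g H i j) = real (card (group_of P g i)) / real m) \<and>
           collision_probability P m H = 1 / real m \<and>
           (\<forall>i\<in>{1, 2}. single_fairness P g m H i = 1 / real m)"
    if ps: "set ps = P" "distinct ps" "card P = n" and g: "\<forall>p\<in>P. g p \<in> {1, 2}"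
      and ne: "group_of P g 1 \<noteq> {}" "group_of P g 2 \<noteq> {}"
      and m: "m \<ge> 1" and dvd: "m dvd card (group_of P g 1)" "m dvd card (group_of P g 2)"
    for P :: "'p set" and ps x g n m
  proof -
    define I where "I = point_input ps x g"
    have I: "key I i = x (ps ! i)" "grp I i = g (ps ! i)" for i
      by (simp_all add: I_def point_input_def)
    have len: "length ps = n" using ps distinct_card by metis
    have fin: "finite P" using ps by auto
    have "P = group_of P g 1 \<union> group_of P g 2" "group_of P g 1 \<inter> group_of P g 2 = {}"
      using g by (auto simp: group_of_def)
    then have "n = card (group_of P g 1) + card (group_of P g 2)"
      using ps(3) fin card_Un_disjoint by (metis finite_Un)
    then have "m dvd n" using dvd by simp
    then obtain L where n: "n = m * L" ..
    obtain a where a: "card (group_of P g 1) = m * a" using dvd(1) ..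
    have npos: "0 < n" using ne fin ps(3) by (auto simp: group_of_def card_gt_0_iff)
    have nth: "(!) ps ` {..<n} = P"
      using ps(1) len by (auto simp: set_conv_nth)
    have c1: "(\<Sum>i<n. 2 - grp I i) = m * a"
      using card_nth_image_group[of ps "{..<n}" g] ps g len nth a
      by (simp add: I group_of_def)
    have grp: "grp I i \<in> {1, 2}" if "i < n" for i
      using g nth that by (auto simp: I)
    obtain t s C r where ex: "exec I hashmap_prog (initial_state n m) t s"
      and srt: "\<forall>u v. u < v \<and> v < n \<longrightarrow> key I (arrays s ''order'' u) \<le> key I (arrays s ''order'' v)"
      and perm: "arrays s ''order'' ` {..<n} = {..<n}"
      and inv: "balanced_colouring (\<lambda>q. 2 - grp I (arrays s ''order'' q)) n L a m C"
      and bs: "map (arrays s ''boundaries'') [0..<vars s ''k''] = colour_changes C n"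
      and asg: "bin_colours C n (arrays s ''assign'')"
      and r: "2 ^ r \<le> 2 * n" and t: "t \<le> 300 * n * r + 310 * n + 150"
      using wp_hashmap_prog[OF grp m n npos c1] unfolding wp_def add_0 by blast
    have "real r \<le> log 2 (2 * n)"
      using r npos by (simp add: le_log_iff powr_realpow flip: of_nat_le_iff[where 'a = real])
    also have "\<dots> = 1 + ln n / ln 2"
      using npos by (simp add: log_def ln_mult field_simps)
    finally have "300 * real n * real r \<le> 300 * real n * (1 + ln n / ln 2)"
      by (intro mult_left_mono) auto
    moreover have "real t \<le> 300 * real n * real r + 310 * real n + 150"
      using t by (simp flip: of_nat_le_iff[where 'a = real])
    ultimately have "real t \<le> F n" unfolding F_def by linarith
    then have tT: "t \<le> T n" unfolding T_def by (simp add: le_nat_floor)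
    define ys where "ys = map (\<lambda>i. ps ! arrays s ''order'' i) [0..<n]"
    have ysn: "ys ! q = ps ! arrays s ''order'' q" if "q < n" for q
      using that by (simp add: ys_def)
    have H: "output_hashmap ps s = Hashmap ys (colour_changes C n) (arrays s ''assign'')"
      by (simp add: output_hashmap_def ys_def len bs)
    have inj: "inj_on (arrays s ''order'') {..<n}"
      by (rule finite_surj_inj) (use perm in auto)
    have "inj_on (\<lambda>i. ps ! arrays s ''order'' i) {..<n}"
      using comp_inj_on[OF inj, of "(!) ps"] perm ps(2) len
      by (simp add: inj_on_nth o_def)
    then have ys1: "distinct ys"
      by (simp add: ys_def distinct_map lessThan_atLeast0)
    have ys2: "set ys = P"
    proof -
      have "set ys = (!) ps ` arrays s ''order'' ` {..<n}"
        by (simp add: ys_def image_image lessThan_atLeast0)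
      then show ?thesis by (simp add: perm nth)
    qed
    have ys3: "sorted (map x ys)"
      using srt by (auto simp: sorted_iff_nth_mono_less ys_def I)
    have ys4: "length ys = n" by (simp add: ys_def)
    have inv': "balanced_colouring (\<lambda>q. 2 - g (ys ! q)) n L a m C"
      using inv ysn by (subst balanced_colouring_cong[where h' = "\<lambda>q. 2 - grp I (arrays s ''order'' q)"]) (auto simp: I)
    note res = balanced_hashmap[OF ys1 ys2 ys3 ys4 g ne m n a inv' asg, folded H]
    show ?thesis
      using ex[unfolded I_def] tT res by blast
  qed
  show ?thesis
    by (rule exI[of _ hashmap_prog], rule exI[of _ T], rule conjI[OF bigo],
        intro allI impI, elim conjE, rule main)
qed

end
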